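(* Let $w\in C^3(\mathbb R)$ be periodic (period 2) with $w>0$ on $[-1,1]$, let $\Gamma=\{(x,w(x)):x\in(-1,1)\}$, let $-1<a<b<1$, and let $\varphi:[a,b]\to\mathbb R$ be a polynomial with $\varphi^{(k)}(a)=\varphi^{(k)}(b)=0$ for $k=0,1,2,3$, extended by zero outside $[a,b]$. If $\|\varphi\|_{C^{2,\alpha}(a,b)}$ is sufficiently small (depending on $w$), then there exists an admissible flow $\{\Phi_s\}_{s\in[0,1]}$ such that, for every $s\in[0,1]$, $$\Phi_s(\Gamma)=\{(x,w(x)+s\varphi(x)):x\in(-1,1)\}\quad\text{and}\quad X_s\cdot\tau_s=0\ \text{ on }\Gamma_s.$$
   Context: $\Omega=(-1,1)\times(0,\infty)$. Admissible flow: a family $\{\Phi_s\}_{s\in[0,1]}$ with (i) $(s,\boldsymbol x)\mapsto\Phi_s(\boldsymbol x)$ in $C^2([0,1]\times\overline\Omega;\mathbb R^2)$; (ii) each $\Phi_s$ a diffeomorphism of $\overline\Omega$ onto itself; (iii) $\Phi_0=\mathrm{Id}$; (iv) there is an open $U\Subset\Omega$ with $\operatorname{supp}(\Phi_s-\mathrm{Id})\subset U$ for all $s$. On $\Gamma$, $\tau=(1,w')/\sqrt{1+w'^2}$. $X_s=\dot\Phi_s\circ\Phi_s^{-1}$ with $\dot\Phi_s=\partial_r\Phi_r|_{r=s}$, $\Gamma_s=\Phi_s(\Gamma)$, $\tau_s=\frac{(D\Phi_s)\tau}{|(D\Phi_s)\tau|}\circ\Phi_s^{-1}$ the unit tangent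 to $\Gamma_s$. *)

theory Defs
  imports "HOL-Analysis.Analysis" "HOL-Computational_Algebra.Polynomial"
begin

type_synonym pt = "real \<times> real"

definition Omega :: "pt set" where
  "Omega = {-1<..<1} \<times> {0<..}"

definition Omega_bar :: "pt set" where
  "Omega_bar = closure Omega"

definition Gamma :: "(real \<Rightarrow> real) \<Rightarrow> pt set" where
  "Gamma w = {(x, w x) | x. -1 < x \<and> x < 1}"

definition tau :: "(real \<Rightarrow> real) \<Rightarrow> pt \<Rightarrow> pt" where
  "tau w q = (1 / sqrt (1 + (deriv w (fst q))\<^sup>2)) *\<^sub>R (1, deriv w (fst q))"

definition C3_real :: "(real \<Rightarrow> real) \<Rightarrow> bool" where
  "C3_real w \<longleftrightarrow>
     (\<forall>k<3. \<forall>x. ((deriv ^^ k) w has_real_derivative (deriv ^^ Suc k) w x) (at x))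
     \<and> continuous_on UNIV ((deriv ^^ 3) w)"

definition C1_open :: "'a::real_normed_vector set \<Rightarrow> ('a \<Rightarrow> 'b::real_normed_vector) \<Rightarrow> bool" where
  "C1_open V f \<longleftrightarrow> (\<exists>f'. (\<forall>x\<in>V. (f has_derivative blinfun_apply (f' x)) (at x)) \<and> continuous_on V f')"

definition C2_open :: "'a::real_normed_vector set \<Rightarrow> ('a \<Rightarrow> 'b::real_normed_vector) \<Rightarrow> bool" where
  "C2_open V f \<longleftrightarrow> (\<exists>f'. (\<forall>x\<in>V. (f has_derivative blinfun_apply (f' x)) (at x)) \<and> C1_open V f')"

text \<open>C^k up to the boundary of an arbitrary set S: restriction of a C^k function on an open
  neighbourhood of S.\<close>
definition C1_on :: "'a::real_normed_vector set \<Rightarrow> ('a \<Rightarrow> 'b::real_normed_vector) \<Rightarrow> bool" where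
  "C1_on S f \<longleftrightarrow> (\<exists>V F. open V \<and> S \<subseteq> V \<and> C1_open V F \<and> (\<forall>x\<in>S. F x = f x))"

definition C2_on :: "'a::real_normed_vector set \<Rightarrow> ('a \<Rightarrow> 'b::real_normed_vector) \<Rightarrow> bool" where
  "C2_on S f \<longleftrightarrow> (\<exists>V F. open V \<and> S \<subseteq> V \<and> C2_open V F \<and> (\<forall>x\<in>S. F x = f x))"

definition diffeo_onto :: "pt set \<Rightarrow> (pt \<Rightarrow> pt) \<Rightarrow> bool" where
  "diffeo_onto S f \<longleftrightarrow> bij_betw f S S \<and> C1_on S f \<and> C1_on S (inv_into S f)"

definition admissible_flow :: "(real \<Rightarrow> pt \<Rightarrow> pt) \<Rightarrow> bool" where
  "admissible_flow \<Phi> \<longleftrightarrow>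
     C2_on ({0..1} \<times> Omega_bar) (\<lambda>(s, x). \<Phi> s x)
   \<and> (\<forall>s\<in>{0..1}. diffeo_onto Omega_bar (\<Phi> s))
   \<and> (\<forall>x\<in>Omega_bar. \<Phi> 0 x = x)
   \<and> (\<exists>U. open U \<and> compact (closure U) \<and> closure U \<subseteq> Omega \<and>
          (\<forall>s\<in>{0..1}. closure {x\<in>Omega_bar. \<Phi> s x \<noteq> x} \<subseteq> U))"

definition flow_dot :: "(real \<Rightarrow> pt \<Rightarrow> pt) \<Rightarrow> real \<Rightarrow> pt \<Rightarrow> pt" where
  "flow_dot \<Phi> s q = vector_derivative (\<lambda>r. \<Phi> r q) (at s within {0..1})"

definition velocity :: "(real \<Rightarrow> pt \<Rightarrow> pt) \<Rightarrow> real \<Rightarrow> pt \<Rightarrow> pt" where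
  "velocity \<Phi> s p = flow_dot \<Phi> s (inv_into Omega_bar (\<Phi> s) p)"

definition tau_s :: "(real \<Rightarrow> real) \<Rightarrow> (real \<Rightarrow> pt \<Rightarrow> pt) \<Rightarrow> real \<Rightarrow> pt \<Rightarrow> pt" where
  "tau_s w \<Phi> s p =
     (let q = inv_into Omega_bar (\<Phi> s) p;
          v = frechet_derivative (\<Phi> s) (at q) (tau w q)
      in (1 / norm v) *\<^sub>R v)"

definition phi_ext :: "real \<Rightarrow> real \<Rightarrow> real poly \<Rightarrow> real \<Rightarrow> real" where
  "phi_ext a b p x = (if a \<le> x \<and> x \<le> b then poly p x else 0)"

definition C2alpha_norm :: "real \<Rightarrow> real \<Rightarrow> real \<Rightarrow> (real \<Rightarrow> real) \<Rightarrow> real" where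
  "C2alpha_norm \<alpha> a b f =
     (SUP x\<in>{a<..<b}. \<bar>f x\<bar>) + (SUP x\<in>{a<..<b}. \<bar>deriv f x\<bar>)
     + (SUP x\<in>{a<..<b}. \<bar>(deriv ^^ 2) f x\<bar>)
     + (SUP xy\<in>{(x, y). x \<in> {a<..<b} \<and> y \<in> {a<..<b} \<and> x \<noteq> y}.
          \<bar>(deriv ^^ 2) f (fst xy) - (deriv ^^ 2) f (snd xy)\<bar> / \<bar>fst xy - snd xy\<bar> powr \<alpha>)"

end

theory Submission
  imports Defs
begin

text \<open>
  On the graph of \<open>g = w + s \<phi>\<close> the flow is forced: orthogonality to the tangent \<open>(1, g')\<close> means that
  the abscissa of a material point solves \<open>\<xi>' = - \<phi> g' / (1 + g'\<^sup>2)\<close>. The right-hand side of this scalar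
  equation is \<open>C\<^sup>2\<close>. Since the difference of two solutions of a scalar equation solves a linear one,
  \<open>\<partial>\<xi>/\<partial>x\<close> is an explicit exponential of an integral along the solution, from which joint \<open>C\<^sup>2\<close>
  regularity of \<open>\<xi>\<close> can be read off. The displacement of the point of \<open>\<Gamma>\<close> with abscissa \<open>x\<close> is
  extended to the strip by multiplying it with a cut-off \<open>\<eta>(y)\<close> that equals \<open>1\<close> on the range
  of \<open>w\<close>. The resulting map is the identity plus a perturbation whose differential has norm at most
  \<open>1/2\<close>, because the displacement is controlled by the \<open>C\<^sup>2\<close> norm of \<open>\<phi>\<close>; hence it is a diffeomorphism.
\<close>

section \<open>Calculus of C1 and C2 maps\<close>

text \<open>The obstacle is regularity. The speed contains \<open>w'\<close> and
  \<open>\<phi>'\<close>, so one derivative is lost, while joint C2 dependence on time and initial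
  abscissa calls for a C2 right-hand side. Hence \<open>w\<close> is C3, and the derivatives of
  \<open>\<phi>\<close> up to order three vanish at both ends, which makes the extension by zero C3.
  Size estimates involve fewer derivatives: the space derivative of the speed contains only
  \<open>w''\<close> and \<open>\<phi>''\<close>. The cut-off depends on \<open>y\<close> alone. In
  \<open>x\<close> the displacement is compactly supported by itself, because the speed vanishes off
  \<open>(a, b)\<close> and abscissae there stay fixed. The map is built and inverted on the whole
  plane; being the identity off a compact subset of \<open>Omega\<close>, it restricts to the closed
  strip without any argument at the boundary. One \<open>K \<ge> 1\<close> bounds \<open>w'\<close>
  and \<open>w''\<close> on \<open>[-1, 1]\<close> and \<open>\<eta>'\<close>. The threshold is of
  order \<open>1/K\<^sup>2\<close> because the slope of the vertical displacement contains
  \<open>w'\<close> times the deviation of \<open>\<partial>\<xi>/\<partial>x\<close> from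
  \<open>1\<close>, and each of them brings a factor \<open>K\<close>.\<close>

lemma blinfun_compose_apply_eq: "blinfun_apply (f o\<^sub>L g) = (\<lambda>x. blinfun_apply f (blinfun_apply g x))"
  by (simp add: fun_eq_iff)

lemma C1_openI:
  assumes "\<And>x. x \<in> V \<Longrightarrow> (f has_derivative blinfun_apply (f' x)) (at x)" "continuous_on V f'"
  shows "C1_open V f"
  using assms unfolding C1_open_def by blast

lemma C1_open_imp_continuous_on: "C1_open V f \<Longrightarrow> continuous_on V f"
  unfolding C1_open_def
  by (meson continuous_at_imp_continuous_on has_derivative_continuous)

lemma C2_open_imp_C1_open: "C2_open V f \<Longrightarrow> C1_open V f"
  unfolding C2_open_def using C1_openI C1_open_imp_continuous_on by blast

lemma C1_open_bounded_linear:
  assumes L: "bounded_linear L" and f: "C1_open V f"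
  shows "C1_open V (\<lambda>x. L (f x))"
proof -
  obtain f' where f': "\<And>x. x \<in> V \<Longrightarrow> (f has_derivative blinfun_apply (f' x)) (at x)" "continuous_on V f'"
    using f unfolding C1_open_def by blast
  show ?thesis
  proof (rule C1_openI)
    show "((\<lambda>x. L (f x)) has_derivative blinfun_apply (Blinfun L o\<^sub>L f' x)) (at x)" if "x \<in> V" for x
    proof -
      have "blinfun_apply (Blinfun L o\<^sub>L f' x) = (\<lambda>h. L (blinfun_apply (f' x) h))"
        by (simp add: fun_eq_iff bounded_linear_Blinfun_apply[OF L])
      thus ?thesis using bounded_linear.has_derivative[OF L f'(1)[OF that]] by simp
    qed
    show "continuous_on V (\<lambda>x. Blinfun L o\<^sub>L f' x)"
      by (intro continuous_intros f')
  qed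
qed

lemma C1_open_add:
  assumes "C1_open V f" "C1_open V g"
  shows "C1_open V (\<lambda>x. f x + g x)"
proof -
  obtain f' g' where
    f': "\<And>x. x \<in> V \<Longrightarrow> (f has_derivative blinfun_apply (f' x)) (at x)" "continuous_on V f'" and
    g': "\<And>x. x \<in> V \<Longrightarrow> (g has_derivative blinfun_apply (g' x)) (at x)" "continuous_on V g'"
    using assms unfolding C1_open_def by blast
  show ?thesis
  proof (rule C1_openI)
    show "((\<lambda>x. f x + g x) has_derivative blinfun_apply (f' x + g' x)) (at x)" if "x \<in> V" for x
      using has_derivative_add[OF f'(1) g'(1), OF that that] by (simp add: plus_blinfun.rep_eq)
    show "continuous_on V (\<lambda>x. f' x + g' x)"
      by (intro continuous_intros f' g')
  qed
qed

text \<open>Stated for an arbitrary bounded bilinear map because it serves products of reals,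
  scaling, and composition of differentials; the last one is what the chain rule has to
  differentiate in \<open>C2_open_compose\<close>.\<close>

lemma C1_open_bilinear:
  assumes B: "bounded_bilinear B" and "C1_open V f" "C1_open V g"
  shows "C1_open V (\<lambda>x. B (f x) (g x))"
proof -
  interpret bounded_bilinear B by fact
  obtain f' g' where
    f': "\<And>x. x \<in> V \<Longrightarrow> (f has_derivative blinfun_apply (f' x)) (at x)" "continuous_on V f'" and
    g': "\<And>x. x \<in> V \<Longrightarrow> (g has_derivative blinfun_apply (g' x)) (at x)" "continuous_on V g'"
    using assms unfolding C1_open_def by blast
  have cf: "continuous_on V f" "continuous_on V g"
    using assms C1_open_imp_continuous_on by auto
  have l: "blinfun_apply (prod_left b o\<^sub>L A) = (\<lambda>h. B (A h) b)"
      "blinfun_apply (prod_right a o\<^sub>L A') = (\<lambda>h. B a (A' h))" for a b A A'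
    by (auto simp: prod_left.rep_eq prod_right.rep_eq)
  show ?thesis
  proof (rule C1_openI)
    show "((\<lambda>x. B (f x) (g x)) has_derivative
        blinfun_apply ((prod_right (f x) o\<^sub>L g' x) + (prod_left (g x) o\<^sub>L f' x))) (at x)" if "x \<in> V" for x
      using FDERIV[OF f'(1) g'(1), OF that that] by (simp add: plus_blinfun.rep_eq l)
    show "continuous_on V (\<lambda>x. (prod_right (f x) o\<^sub>L g' x) + (prod_left (g x) o\<^sub>L f' x))"
      by (intro continuous_intros f' g' cf bounded_linear.continuous_on[OF bounded_linear_prod_left]
         bounded_linear.continuous_on[OF bounded_linear_prod_right])
  qed
qed

lemma C1_open_compose:
  assumes "C1_open T g" "C1_open V f" "\<And>x. x \<in> V \<Longrightarrow> f x \<in> T"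
  shows "C1_open V (\<lambda>x. g (f x))"
proof -
  obtain f' g' where
    f': "\<And>x. x \<in> V \<Longrightarrow> (f has_derivative blinfun_apply (f' x)) (at x)" "continuous_on V f'" and
    g': "\<And>x. x \<in> T \<Longrightarrow> (g has_derivative blinfun_apply (g' x)) (at x)" "continuous_on T g'"
    using assms unfolding C1_open_def by blast
  have cf: "continuous_on V f"
    using assms C1_open_imp_continuous_on by auto
  show ?thesis
  proof (rule C1_openI)
    show "((\<lambda>x. g (f x)) has_derivative blinfun_apply (g' (f x) o\<^sub>L f' x)) (at x)" if "x \<in> V" for x
      using has_derivative_compose[OF f'(1)[OF that] g'(1)[OF assms(3)[OF that]]]
      by (simp add: blinfun_compose_apply_eq)
    show "continuous_on V (\<lambda>x. g' (f x) o\<^sub>L f' x)"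
      by (intro continuous_intros f' continuous_on_compose2[OF g'(2) cf]) (use assms in auto)
  qed
qed

lemma C1_open_const: "C1_open V (\<lambda>x. c)"
  by (rule C1_openI[where f'="\<lambda>x. 0"]) (auto simp: zero_blinfun.rep_eq)

lemma C1_open_linear: "bounded_linear L \<Longrightarrow> C1_open V L"
  by (rule C1_openI[where f'="\<lambda>x. Blinfun L"])
     (auto simp: bounded_linear_Blinfun_apply bounded_linear_imp_has_derivative)

lemma C2_openI:
  assumes "\<And>x. x \<in> V \<Longrightarrow> (f has_derivative blinfun_apply (f' x)) (at x)" "C1_open V f'"
  shows "C2_open V f"
  using assms unfolding C2_open_def by blast

lemma C2_open_linear: "bounded_linear L \<Longrightarrow> C2_open V L"
  by (rule C2_openI[where f'="\<lambda>x. Blinfun L"])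
     (auto simp: bounded_linear_Blinfun_apply bounded_linear_imp_has_derivative C1_open_const)

lemma C2_open_compose:
  assumes "C2_open T g" "C2_open V f" "\<And>x. x \<in> V \<Longrightarrow> f x \<in> T"
  shows "C2_open V (\<lambda>x. g (f x))"
proof -
  obtain f' g' where
    f': "\<And>x. x \<in> V \<Longrightarrow> (f has_derivative blinfun_apply (f' x)) (at x)" "C1_open V f'" and
    g': "\<And>x. x \<in> T \<Longrightarrow> (g has_derivative blinfun_apply (g' x)) (at x)" "C1_open T g'"
    using assms unfolding C2_open_def by blast
  show ?thesis
  proof (rule C2_openI)
    show "((\<lambda>x. g (f x)) has_derivative blinfun_apply (g' (f x) o\<^sub>L f' x)) (at x)" if "x \<in> V" for x
      using has_derivative_compose[OF f'(1)[OF that] g'(1)[OF assms(3)[OF that]]]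
      by (simp add: blinfun_compose_apply_eq)
    show "C1_open V (\<lambda>x. g' (f x) o\<^sub>L f' x)"
      by (intro C1_open_bilinear[OF bounded_bilinear_blinfun_compose] f'
          C1_open_compose[OF g'(2)] C2_open_imp_C1_open assms)
  qed
qed

lemma C2_open_add:
  assumes "C2_open V f" "C2_open V g"
  shows "C2_open V (\<lambda>x. f x + g x)"
proof -
  obtain f' g' where
    f': "\<And>x. x \<in> V \<Longrightarrow> (f has_derivative blinfun_apply (f' x)) (at x)" "C1_open V f'" and
    g': "\<And>x. x \<in> V \<Longrightarrow> (g has_derivative blinfun_apply (g' x)) (at x)" "C1_open V g'"
    using assms unfolding C2_open_def by blast
  show ?thesis
  proof (rule C2_openI)
    show "((\<lambda>x. f x + g x) has_derivative blinfun_apply (f' x + g' x)) (at x)" if "x \<in> V" for x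
      using has_derivative_add[OF f'(1) g'(1), OF that that] by (simp add: plus_blinfun.rep_eq)
    show "C1_open V (\<lambda>x. f' x + g' x)"
      by (intro C1_open_add f' g')
  qed
qed

lemma C2_open_bilinear:
  assumes B: "bounded_bilinear B" and "C2_open V f" "C2_open V g"
  shows "C2_open V (\<lambda>x. B (f x) (g x))"
proof -
  interpret bounded_bilinear B by fact
  obtain f' g' where
    f': "\<And>x. x \<in> V \<Longrightarrow> (f has_derivative blinfun_apply (f' x)) (at x)" "C1_open V f'" and
    g': "\<And>x. x \<in> V \<Longrightarrow> (g has_derivative blinfun_apply (g' x)) (at x)" "C1_open V g'"
    using assms unfolding C2_open_def by blast
  have l: "blinfun_apply (prod_left b o\<^sub>L A) = (\<lambda>h. B (A h) b)"
      "blinfun_apply (prod_right a o\<^sub>L A') = (\<lambda>h. B a (A' h))" for a b A A'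
    by (auto simp: prod_left.rep_eq prod_right.rep_eq)
  show ?thesis
  proof (rule C2_openI)
    show "((\<lambda>x. B (f x) (g x)) has_derivative
        blinfun_apply ((prod_right (f x) o\<^sub>L g' x) + (prod_left (g x) o\<^sub>L f' x))) (at x)" if "x \<in> V" for x
      using FDERIV[OF f'(1) g'(1), OF that that] by (simp add: plus_blinfun.rep_eq l)
    show "C1_open V (\<lambda>x. (prod_right (f x) o\<^sub>L g' x) + (prod_left (g x) o\<^sub>L f' x))"
      by (intro C1_open_add C1_open_bilinear[OF bounded_bilinear_blinfun_compose] f' g'
         C1_open_bounded_linear[OF bounded_linear_prod_left]
         C1_open_bounded_linear[OF bounded_linear_prod_right] C2_open_imp_C1_open assms)
  qed
qed

lemma C2_open_bounded_linear:
  "bounded_linear L \<Longrightarrow> C2_open V f \<Longrightarrow> C2_open V (\<lambda>x. L (f x))"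
  by (rule C2_open_compose[OF C2_open_linear[where V = UNIV]]) auto

lemma C2_open_diff:
  assumes "C2_open V f" "C2_open V g"
  shows "C2_open V (\<lambda>x. f x - g x)"
  using C2_open_add[OF assms(1) C2_open_bounded_linear[OF bounded_linear_minus[OF bounded_linear_ident] assms(2)]]
  by simp

lemma C2_open_Pair:
  assumes "C2_open V f" "C2_open V g"
  shows "C2_open V (\<lambda>x. (f x, g x))"
proof -
  have "C2_open V (\<lambda>x. (f x, 0) + (0, g x))"
    by (intro C2_open_add C2_open_bounded_linear[OF _ assms(1)] C2_open_bounded_linear[OF _ assms(2)]
       bounded_linear_Pair bounded_linear_ident bounded_linear_zero)
  thus ?thesis by simp
qed

lemma C1_open_Pair:
  assumes "C1_open V f" "C1_open V g"
  shows "C1_open V (\<lambda>x. (f x, g x))"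
proof -
  have "C1_open V (\<lambda>x. (f x, 0) + (0, g x))"
    by (intro C1_open_add C1_open_bounded_linear[OF _ assms(1)] C1_open_bounded_linear[OF _ assms(2)]
       bounded_linear_Pair bounded_linear_ident bounded_linear_zero)
  thus ?thesis by simp
qed

section \<open>Regularity of real functions of one and two variables, read off from their
  derivatives\<close>

lemma has_real_derivative_blinfun:
  "(f has_real_derivative d) F \<longleftrightarrow> (f has_derivative blinfun_apply (blinfun_scaleR_left d)) F"
proof -
  have "blinfun_apply (blinfun_scaleR_left d) = (*) d"
    by (simp add: fun_eq_iff mult.commute)
  thus ?thesis by (simp add: has_field_derivative_def)
qed

lemma C1_open_real:
  assumes "\<And>x. x \<in> V \<Longrightarrow> (f has_real_derivative f' x) (at x)" "continuous_on V f'"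
  shows "C1_open V f"
  by (rule C1_openI[where f'="\<lambda>x. blinfun_scaleR_left (f' x)"])
     (use assms in \<open>auto simp: has_real_derivative_blinfun simp del: blinfun_scaleR_left.rep_eq
       intro!: bounded_linear.continuous_on[OF bounded_linear_blinfun_scaleR_left]\<close>)

lemma C2_open_real:
  assumes "\<And>x. x \<in> V \<Longrightarrow> (f has_real_derivative f' x) (at x)" "C1_open V f'"
  shows "C2_open V f"
  by (rule C2_openI[where f'="\<lambda>x. blinfun_scaleR_left (f' x)"])
     (use assms in \<open>auto simp: has_real_derivative_blinfun simp del: blinfun_scaleR_left.rep_eq
       intro!: C1_open_bounded_linear[OF bounded_linear_blinfun_scaleR_left]\<close>)

definition blinfun_partials :: "real \<Rightarrow> real \<Rightarrow> (real \<times> real) \<Rightarrow>\<^sub>L real" where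
  "blinfun_partials a b =
     (blinfun_scaleR_left a o\<^sub>L Blinfun fst) + (blinfun_scaleR_left b o\<^sub>L Blinfun snd)"

lemma blinfun_partials_apply [simp]: "blinfun_apply (blinfun_partials a b) (h, k) = a * h + b * k"
  by (simp add: blinfun_partials_def plus_blinfun.rep_eq bounded_linear_Blinfun_apply
      bounded_linear_fst bounded_linear_snd mult.commute)

lemma has_derivative_real_partials:
  fixes f :: "real \<Rightarrow> real \<Rightarrow> real"
  assumes T: "open T" "s \<in> T"
    and fs: "\<And>s x. s \<in> T \<Longrightarrow> ((\<lambda>s. f s x) has_real_derivative fs s x) (at s)"
    and fx: "\<And>s x. s \<in> T \<Longrightarrow> (f s has_real_derivative fx s x) (at x)"
    and cx: "continuous_on (T \<times> UNIV) (\<lambda>(s, x). fx s x)"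
  shows "((\<lambda>(s, x). f s x) has_derivative blinfun_apply (blinfun_partials (fs s x) (fx s x))) (at (s, x))"
proof -
  have "((\<lambda>(s, x). f s x) has_derivative
      (\<lambda>(h, k). blinfun_apply (blinfun_scaleR_left (fs s x)) h + blinfun_apply (blinfun_scaleR_left (fx s x)) k))
      (at (s, x) within T \<times> UNIV)"
  proof (rule has_derivative_partialsI)
    show "((\<lambda>s. f s x) has_derivative blinfun_apply (blinfun_scaleR_left (fs s x))) (at s within T)"
      using fs[OF T(2), of x] unfolding has_real_derivative_blinfun
      by (rule has_derivative_at_withinI)
    show "((\<lambda>y. f x y) has_derivative blinfun_apply (blinfun_scaleR_left (fx x y))) (at y within UNIV)"
      if "x \<in> T" for x y
      using fx[OF that, of y] unfolding has_real_derivative_blinfun .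
    have "continuous_on (T \<times> UNIV) (\<lambda>z. blinfun_scaleR_left (case z of (s, x) \<Rightarrow> fx s x))"
      by (rule bounded_linear.continuous_on[OF bounded_linear_blinfun_scaleR_left cx])
    thus "continuous (at (s, x) within T \<times> UNIV) (\<lambda>(x, y). blinfun_scaleR_left (fx x y))"
      using T unfolding continuous_on_eq_continuous_within split_beta by auto
  qed auto
  moreover have "at (s, x) within T \<times> UNIV = at (s, x)"
    using T by (intro at_within_open open_Times) auto
  moreover have "(\<lambda>(h, k). blinfun_apply (blinfun_scaleR_left (fs s x)) h + blinfun_apply (blinfun_scaleR_left (fx s x)) k)
     = blinfun_apply (blinfun_partials (fs s x) (fx s x))"
    by (auto simp: fun_eq_iff)
  ultimately show ?thesis by simp
qed

text \<open>Writes the differential as a combination of two fixed forms, so that its regularity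
  reduces to that of the partial derivatives.\<close>

lemma blinfun_partials_alt:
  "blinfun_partials a b = a *\<^sub>R blinfun_partials 1 0 + b *\<^sub>R blinfun_partials 0 1"
  by (rule blinfun_eqI) (auto simp: plus_blinfun.rep_eq scaleR_blinfun.rep_eq)

lemma C1_open_partials:
  fixes f :: "real \<Rightarrow> real \<Rightarrow> real"
  assumes T: "open T"
    and fs: "\<And>s x. s \<in> T \<Longrightarrow> ((\<lambda>s. f s x) has_real_derivative fs s x) (at s)"
    and fx: "\<And>s x. s \<in> T \<Longrightarrow> (f s has_real_derivative fx s x) (at x)"
    and c: "continuous_on (T \<times> UNIV) (\<lambda>(s, x). fs s x)" "continuous_on (T \<times> UNIV) (\<lambda>(s, x). fx s x)"
  shows "C1_open (T \<times> UNIV) (\<lambda>(s, x). f s x)"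
proof (rule C1_openI[where f'="\<lambda>z. blinfun_partials (case z of (s,x) \<Rightarrow> fs s x) (case z of (s,x) \<Rightarrow> fx s x)"])
  show "continuous_on (T \<times> UNIV) (\<lambda>z. blinfun_partials (case z of (s,x) \<Rightarrow> fs s x) (case z of (s,x) \<Rightarrow> fx s x))"
    by (subst blinfun_partials_alt) (intro continuous_intros c)
qed (use has_derivative_real_partials[OF T _ fs fx c(2)] in auto)

lemma C2_open_partials:
  fixes f :: "real \<Rightarrow> real \<Rightarrow> real"
  assumes T: "open T"
    and fs: "\<And>s x. s \<in> T \<Longrightarrow> ((\<lambda>s. f s x) has_real_derivative fs s x) (at s)"
    and fx: "\<And>s x. s \<in> T \<Longrightarrow> (f s has_real_derivative fx s x) (at x)"
    and c: "C1_open (T \<times> UNIV) (\<lambda>(s, x). fs s x)" "C1_open (T \<times> UNIV) (\<lambda>(s, x). fx s x)"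
  shows "C2_open (T \<times> UNIV) (\<lambda>(s, x). f s x)"
proof (rule C2_openI[where f'="\<lambda>z. blinfun_partials (case z of (s,x) \<Rightarrow> fs s x) (case z of (s,x) \<Rightarrow> fx s x)"])
  show "C1_open (T \<times> UNIV) (\<lambda>z. blinfun_partials (case z of (s,x) \<Rightarrow> fs s x) (case z of (s,x) \<Rightarrow> fx s x))"
    by (subst blinfun_partials_alt)
       (intro C1_open_add C1_open_bilinear[OF bounded_bilinear_scaleR] c C1_open_const)
qed (use has_derivative_real_partials[OF T _ fs fx C1_open_imp_continuous_on[OF c(2)]] in auto)

section \<open>Small perturbations of the identity\<close>

text \<open>A preimage of \<open>y\<close> is a fixed point of the contraction
  \<open>x \<mapsto> y - E x\<close>. The same bound gives
  \<open>norm (x - y) \<le> 2 * norm (f x - f y)\<close>, so the inverse is Lipschitz, and its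
  linear version makes each differential injective, hence invertible in finite dimension. Continuity
  of the inverse differentials follows from a resolvent identity.\<close>

lemma small_perturbation_of_identity:
  fixes E :: "'a::euclidean_space \<Rightarrow> 'a"
  assumes C1: "C1_open UNIV E"
    and small: "\<And>E' x h. (E has_derivative E') (at x) \<Longrightarrow> norm (E' h) \<le> norm h / 2"
  shows "bij (\<lambda>x. x + E x)" "C1_open UNIV (inv (\<lambda>x. x + E x))"
proof -
  obtain E' where E': "\<And>x. (E has_derivative blinfun_apply (E' x)) (at x)" "continuous_on UNIV E'"
    using C1 unfolding C1_open_def by auto
  define f where "f = (\<lambda>x. x + E x)"
  define g where "g = inv f"
  have nE': "norm (E' x h) \<le> norm h / 2" for x h
    using small[OF E'(1)] .
  have lip: "norm (E x - E y) \<le> 1/2 * norm (x - y)" for x y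
  proof (rule differentiable_bound[where S=UNIV and f'="\<lambda>x. blinfun_apply (E' x)"])
    show "onorm (blinfun_apply (E' x)) \<le> 1/2" for x
      by (rule onorm_bound) (use nE' in auto)
  qed (use E' in auto)
  have ex1: "\<exists>!x. f x = y" for y
  proof -
    have "\<exists>!x. y - E x = x"
      by (rule banach_fix_type[of "1/2"]) (use lip in \<open>auto simp: dist_norm norm_minus_commute\<close>)
    moreover have "y - E x = x \<longleftrightarrow> f x = y" for x
      by (auto simp: f_def algebra_simps)
    ultimately show ?thesis by simp
  qed
  hence bij: "bij f" by (auto simp: bij_iff)
  hence fg: "f (g y) = y" and gf: "g (f x) = x" for x y
    by (auto simp: g_def bij_is_surj surj_f_inv_f bij_is_inj)
  have low: "norm (x - y) \<le> 2 * norm (f x - f y)" for x y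
  proof -
    have "x - y = (f x - f y) - (E x - E y)" by (simp add: f_def)
    hence "norm (x - y) \<le> norm (f x - f y) + norm (E x - E y)"
      using norm_triangle_ineq4 by metis
    thus ?thesis using lip[of x y] by simp
  qed
  have "norm (g u - g v) \<le> 2 * norm (u - v)" for u v
    using low[of "g u" "g v"] by (simp add: fg)
  hence "2-lipschitz_on UNIV g"
    by (auto simp: lipschitz_on_def dist_norm)
  hence contg: "continuous_on UNIV g" by (rule lipschitz_on_continuous_on)
  define T where "T x = id_blinfun + E' x" for x
  have T: "T x h = h + E' x h" for x h
    by (simp add: T_def plus_blinfun.rep_eq)
  have derf: "(f has_derivative blinfun_apply (T x)) (at x)" for x
    unfolding f_def T[abs_def] by (auto intro!: derivative_eq_intros E')
  have lowT: "norm h \<le> 2 * norm (T x h)" for x h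
  proof -
    have "h = T x h - E' x h" by (simp add: T)
    hence "norm h \<le> norm (T x h) + norm (E' x h)"
      using norm_triangle_ineq4 by metis
    thus ?thesis using nE'[of x h] by simp
  qed
  have "\<exists>S. linear S \<and> (\<forall>h. S (T x h) = h) \<and> (\<forall>h. T x (S h) = h)" for x
  proof (rule linear_injective_isomorphism)
    show "linear (blinfun_apply (T x))"
      by (simp add: blinfun.bounded_linear_right bounded_linear.linear)
    show "inj (blinfun_apply (T x))"
    proof (rule injI)
      fix u v assume "T x u = T x v"
      thus "u = v" using lowT[of "u - v" x] by (simp add: blinfun.diff_right)
    qed
  qed auto
  then obtain S where S: "\<And>x. linear (S x)" "\<And>x h. S x (T x h) = h" "\<And>x h. T x (S x h) = h"
    by metis
  define R where "R y = Blinfun (S (g y))" for y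
  have R: "blinfun_apply (R y) = S (g y)" for y
    unfolding R_def by (intro bounded_linear_Blinfun_apply linear_conv_bounded_linear[THEN iffD1] S)
  have nR: "norm (R y) \<le> 2" for y
  proof (rule norm_blinfun_bound)
    show "norm (R y h) \<le> 2 * norm h" for h
      using lowT[of "S (g y) h" "g y"] by (simp add: R S)
  qed simp
  have derg: "(g has_derivative blinfun_apply (R y)) (at y)" for y
  proof (rule has_derivative_inverse_basic[where f=f and T=UNIV])
    show "(f has_derivative blinfun_apply (T (g y))) (at (g y))" by (rule derf)
    show "continuous (at y) g" using contg by (simp add: continuous_on_eq_continuous_at)
    show "blinfun_apply (R y) \<circ> blinfun_apply (T (g y)) = id" by (auto simp: R S fun_eq_iff)
  qed (auto simp: fg blinfun.bounded_linear_right)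
  have diffR: "norm (R z - R y) \<le> 4 * norm (E' (g z) - E' (g y))" for y z
  proof -
    \<comment> \<open>The identity
      \<open>A\<inverse> - B\<inverse> = A\<inverse> (B - A) B\<inverse>\<close>; with both inverses
      of norm at most \<open>2\<close> it yields the constant \<open>4\<close>.\<close>
    have "R z - R y = R z o\<^sub>L ((E' (g y) - E' (g z)) o\<^sub>L R y)"
    proof (rule blinfun_eqI)
      fix h
      have "(E' (g y) - E' (g z)) (R y h) = h - T (g z) (R y h)"
        using S(3)[of "g y" h] by (simp add: R T minus_blinfun.rep_eq algebra_simps)
      thus "(R z - R y) h = (R z o\<^sub>L ((E' (g y) - E' (g z)) o\<^sub>L R y)) h"
        using S(2)[of "g z" "R y h"] by (simp add: R minus_blinfun.rep_eq linear_diff[OF S(1)])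
    qed
    also have "norm \<dots> \<le> norm (R z) * (norm (E' (g y) - E' (g z)) * norm (R y))"
      by (rule order_trans[OF norm_blinfun_compose]) (intro mult_left_mono norm_blinfun_compose, simp)
    also have "\<dots> \<le> 2 * (norm (E' (g y) - E' (g z)) * 2)"
      by (intro mult_mono nR mult_nonneg_nonneg) auto
    finally show ?thesis by (simp add: norm_minus_commute)
  qed
  have "isCont R y" for y
  proof -
    have "continuous_on UNIV (\<lambda>z. E' (g z))"
      by (rule continuous_on_compose2[OF E'(2) contg]) auto
    hence "((\<lambda>z. E' (g z)) \<longlongrightarrow> E' (g y)) (at y)"
      by (simp add: continuous_on_eq_continuous_at isCont_def)
    hence "((\<lambda>z. 4 * norm (E' (g z) - E' (g y))) \<longlongrightarrow> 0) (at y)"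
      using LIM_zero tendsto_mult_right_zero tendsto_norm_zero by blast
    hence "((\<lambda>z. R z - R y) \<longlongrightarrow> 0) (at y)"
      by (rule Lim_null_comparison[rotated]) (use diffR in auto)
    thus ?thesis unfolding isCont_def by (rule LIM_zero_cancel)
  qed
  hence "continuous_on UNIV R" by (simp add: continuous_on_eq_continuous_at)
  hence "C1_open UNIV g" using derg by (intro C1_openI)
  thus "bij (\<lambda>x. x + E x)" "C1_open UNIV (inv (\<lambda>x. x + E x))"
    using bij by (simp_all add: f_def g_def)
qed

text \<open>A point outside \<open>S\<close> is its own only preimage, so no point of
  \<open>S\<close> can leave \<open>S\<close> and none can be reached from outside.\<close>

lemma bij_betw_of_id_outside:
  assumes f: "bij f" and id: "\<And>x. x \<notin> S \<Longrightarrow> f x = x"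
  shows "bij_betw f S S"
proof -
  have inj: "inj f" and surj: "surj f" using f by (auto simp: bij_def)
  have "f x \<in> S" if "x \<in> S" for x
    using id[of "f x"] injD[OF inj, of "f x" x] that by (cases "f x \<in> S") auto
  moreover have "y \<in> f ` S" if "y \<in> S" for y
  proof -
    obtain x where "y = f x" using surj by (rule surjE)
    thus ?thesis using id[of x] that by (cases "x \<in> S") auto
  qed
  ultimately show ?thesis
    using inj by (auto simp: bij_betw_def inj_on_def inj_def)
qed

section \<open>The flow of a scalar differential equation\<close>

lemma continuous_on_binary_compose:
  assumes "continuous_on UNIV (\<lambda>(x, y). f x y)" "continuous_on S g" "continuous_on S h"
  shows "continuous_on S (\<lambda>z. f (g z) (h z))"
  using continuous_on_compose2[OF assms(1) continuous_on_Pair[OF assms(2,3)]] by simp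

text \<open>\<open>signed_integral f s\<close> is the integral of \<open>f\<close> from \<open>0\<close> to \<open>s\<close>, also for negative \<open>s\<close>,
  rescaled to a fixed domain of integration so that parametric integral theorems apply.\<close>

definition signed_integral :: "(real \<Rightarrow> real) \<Rightarrow> real \<Rightarrow> real" where
  "signed_integral f s = s * integral {0..1} (\<lambda>t. f (s * t))"

lemma signed_integral_has_derivative:
  assumes f: "continuous_on UNIV f"
  shows "(signed_integral f has_real_derivative f s) (at s)"
proof -
  \<comment> \<open>Puts \<open>0\<close> and \<open>s\<close> in the open interval, so that the
    rescaled integral equals \<open>F r - F 0\<close> on a whole neighbourhood of
    \<open>s\<close>.\<close>
  define c where "c = \<bar>s\<bar> + 1"
  obtain F where F: "\<And>x. x \<in> {-c..c} \<Longrightarrow> (F has_vector_derivative f x) (at x within {-c..c})"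
    using antiderivative_continuous[OF continuous_on_subset[OF f]] by (metis subset_UNIV)
  have eq: "signed_integral f r = F r - F 0" if r: "r \<in> {-c<..<c}" for r
  proof -
    have rt: "r * t \<in> {-c<..<c}" if "t \<in> {0..1}" for t
    proof -
      have "\<bar>r * t\<bar> \<le> \<bar>r\<bar> * 1" using that unfolding abs_mult by (intro mult_left_mono) auto
      thus ?thesis using r by (auto simp: abs_le_iff)
    qed
    have F': "(F has_real_derivative f x) (at x)" if "x \<in> {-c<..<c}" for x
    proof -
      have "(F has_vector_derivative f x) (at x within {-c<..<c})"
        by (rule has_vector_derivative_within_subset[OF F]) (use that in auto)
      thus ?thesis using that by (simp add: has_real_derivative_iff_has_vector_derivative at_within_open_NO_MATCH)
    qed
    have "((\<lambda>t. f (r * t) * r) has_integral (F (r * 1) - F (r * 0))) {0..1}"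
    proof (rule fundamental_theorem_of_calculus)
      fix t :: real assume t: "t \<in> {0..1}"
      have "((\<lambda>t. F (r * t)) has_real_derivative f (r * t) * r) (at t)"
        using F'[OF rt[OF t]] by (rule DERIV_chain2[where g="\<lambda>t. r * t"]) (auto intro!: derivative_eq_intros)
      thus "((\<lambda>t. F (r * t)) has_vector_derivative f (r * t) * r) (at t within {0..1})"
        by (simp add: has_real_derivative_iff_has_vector_derivative[symmetric] has_field_derivative_at_within)
    qed simp
    hence "integral {0..1} (\<lambda>t. f (r * t) * r) = F (r * 1) - F (r * 0)"
      by (rule integral_unique)
    thus ?thesis by (simp add: signed_integral_def mult.commute)
  qed
  have s: "s \<in> {-c<..<c}" by (auto simp: c_def)
  have "(F has_vector_derivative f s) (at s within {-c<..<c})"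
    by (rule has_vector_derivative_within_subset[OF F]) (use s in auto)
  hence "(F has_real_derivative f s) (at s)"
    using s by (simp add: has_real_derivative_iff_has_vector_derivative at_within_open_NO_MATCH)
  hence "((\<lambda>r. F r - F 0) has_real_derivative f s) (at s)"
    by (auto intro!: derivative_eq_intros)
  thus ?thesis
    by (rule has_field_derivative_transform_within_open[where S="{-c<..<c}"]) (use s eq in auto)
qed

lemma signed_integral_0 [simp]: "signed_integral f 0 = 0"
  by (simp add: signed_integral_def)

lemma integrable_signed_integrand:
  fixes f :: "real \<Rightarrow> real"
  assumes "continuous_on UNIV f"
  shows "(\<lambda>t. f (s * t)) integrable_on {0..1::real}"
  by (intro integrable_continuous_interval continuous_on_compose2[OF assms] continuous_intros) auto

text \<open>A convex \<open>S\<close> containing \<open>0\<close> and \<open>s\<close> contains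
  every point \<open>s * t\<close> at which the integrand is evaluated; bounds valid on a time
  interval therefore suffice.\<close>

lemma signed_integral_bound:
  assumes f: "continuous_on UNIV f" and S: "0 \<in> S" "convex S" "s \<in> S"
    and B: "\<And>r. r \<in> S \<Longrightarrow> \<bar>f r\<bar> \<le> B"
  shows "\<bar>signed_integral f s\<bar> \<le> \<bar>s\<bar> * B"
proof -
  have "norm (integral {0..1} (\<lambda>t. f (s * t))) \<le> integral {0..1} (\<lambda>t::real. B)"
  proof (rule integral_norm_bound_integral)
    fix t :: real assume t: "t \<in> {0..1}"
    have "(1 - t) *\<^sub>R 0 + t *\<^sub>R s \<in> S"
      using t by (intro convexD[OF S(2,1,3)]) auto
    thus "norm (f (s * t)) \<le> B" using B[of "s * t"] by (simp add: mult.commute)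
  qed (use integrable_signed_integrand[OF f] in auto)
  hence "\<bar>integral {0..1} (\<lambda>t. f (s * t))\<bar> \<le> B" by simp
  thus ?thesis by (simp add: signed_integral_def abs_mult mult_left_mono)
qed

lemma signed_integral_diff:
  assumes "continuous_on UNIV f" "continuous_on UNIV g"
  shows "signed_integral f s - signed_integral g s = signed_integral (\<lambda>r. f r - g r) s"
  using integrable_signed_integrand[OF assms(1)] integrable_signed_integrand[OF assms(2)]
  by (simp add: signed_integral_def integral_diff right_diff_distrib)

lemma continuous_on_signed_integral_param:
  fixes f :: "'a::topological_space \<Rightarrow> real \<Rightarrow> real"
  assumes "continuous_on UNIV (\<lambda>(r, x). f x r)"
  shows "continuous_on UNIV (\<lambda>(s, x). signed_integral (f x) s)"
proof -
  have "continuous_on UNIV (\<lambda>z. integral (cbox 0 1) (\<lambda>t. f (snd z) (fst z * t)))"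
  proof (rule integral_continuous_on_param)
    show "continuous_on (UNIV \<times> cbox 0 1) (\<lambda>(z, t). f (snd z) (fst z * t))"
      unfolding split_beta by (intro continuous_on_binary_compose[OF assms] continuous_intros)
  qed
  thus ?thesis
    unfolding signed_integral_def split_beta by (auto intro!: continuous_intros)
qed

lemma signed_integral_param_has_derivative:
  fixes f :: "real \<Rightarrow> real \<Rightarrow> real"
  assumes c: "continuous_on UNIV (\<lambda>(r, x). f x r)" "continuous_on UNIV (\<lambda>(r, x). fx x r)"
    and d: "\<And>r x. r \<in> S \<Longrightarrow> ((\<lambda>x. f x r) has_real_derivative fx x r) (at x)"
    and S: "0 \<in> S" "convex S" "s \<in> S"
  shows "((\<lambda>x. signed_integral (f x) s) has_real_derivative signed_integral (fx x) s) (at x)"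
proof -
  have "((\<lambda>x. integral (cbox 0 1) (\<lambda>t. f x (s * t))) has_field_derivative
      integral (cbox 0 1) (\<lambda>t. fx x (s * t))) (at x within UNIV)"
  proof (rule leibniz_rule_field_derivative)
    fix x t :: real assume t: "t \<in> cbox 0 1"
    have "(1 - t) *\<^sub>R 0 + t *\<^sub>R s \<in> S"
      using t by (intro convexD[OF S(2,1,3)]) auto
    thus "((\<lambda>x. f x (s * t)) has_real_derivative fx x (s * t)) (at x within UNIV)"
      using d[of "s * t"] by (simp add: mult.commute)
  next
    fix x
    have "continuous_on UNIV (f x)"
      by (intro continuous_on_binary_compose[OF c(1)] continuous_intros)
    thus "(\<lambda>t. f x (s * t)) integrable_on cbox 0 1"
      using integrable_signed_integrand by auto
  next
    show "continuous_on (UNIV \<times> cbox 0 1) (\<lambda>(x, t). fx x (s * t))"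
      unfolding split_beta by (intro continuous_on_binary_compose[OF c(2)] continuous_intros)
  qed auto
  thus ?thesis
    unfolding signed_integral_def by (auto intro!: derivative_eq_intros)
qed

text \<open>Integrating factor: the product of \<open>d\<close> with
  \<open>exp (- signed_integral A r)\<close> has derivative zero on the convex set
  \<open>S\<close>.\<close>

lemma linear_ode_solution:
  fixes d A :: "real \<Rightarrow> real"
  assumes A: "continuous_on UNIV A" and S: "convex S" "0 \<in> S" "s \<in> S"
    and d: "\<And>r. r \<in> S \<Longrightarrow> (d has_real_derivative A r * d r) (at r within S)"
  shows "d s = d 0 * exp (signed_integral A s)"
proof -
  define h where "h r = d r * exp (- signed_integral A r)" for r
  have "(h has_real_derivative 0) (at r within S)" if "r \<in> S" for r
  proof -
    have "((\<lambda>r. exp (- signed_integral A r)) has_real_derivative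
        exp (- signed_integral A r) * (- A r)) (at r within S)"
      by (intro DERIV_chain2[OF DERIV_exp] Deriv.field_differentiable_minus
          has_field_derivative_at_within[OF signed_integral_has_derivative[OF A]])
    from DERIV_mult[OF d[OF that] this] show ?thesis by (simp add: h_def[abs_def] algebra_simps)
  qed
  then obtain c where "\<And>r. r \<in> S \<Longrightarrow> h r = c"
    using has_field_derivative_zero_constant[OF S(1), of h] by blast
  hence "h s = h 0" using S by simp
  hence "d s * exp (- signed_integral A s) = d 0" by (simp add: h_def)
  thus ?thesis by (simp add: exp_minus field_simps)
qed

text \<open>Solutions are constructed on \<open>[-1, 2]\<close> because \<open>C2_on\<close> asks for an extension to a neighbourhood
  of the time interval \<open>[0, 1]\<close>.\<close>

locale scalar_ode =
  fixes V Vs Vx Vxx :: "real \<Rightarrow> real \<Rightarrow> real" and B L :: real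
  assumes V_s: "\<And>s x. ((\<lambda>s. V s x) has_real_derivative Vs s x) (at s)"
    and V_x: "\<And>s x. (V s has_real_derivative Vx s x) (at x)"
    and V_xx: "\<And>s x. (Vx s has_real_derivative Vxx s x) (at x)"
    and cont_V: "continuous_on UNIV (\<lambda>(s, x). V s x)"
    and cont_Vs: "continuous_on UNIV (\<lambda>(s, x). Vs s x)"
    and cont_Vx: "continuous_on UNIV (\<lambda>(s, x). Vx s x)"
    and cont_Vxx: "continuous_on UNIV (\<lambda>(s, x). Vxx s x)"
    and V_bound: "\<And>s x. s \<in> {-1..2} \<Longrightarrow> \<bar>V s x\<bar> \<le> B"
    and Vx_bound: "\<And>s x. s \<in> {-1..2} \<Longrightarrow> \<bar>Vx s x\<bar> \<le> L"
    and L_small: "L \<le> 1/4"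
begin

text \<open>The difference quotient of \<open>V r\<close> in integral form. Unlike the quotient
  itself it is defined and continuous across the diagonal, where its value is
  \<open>Vx\<close>.\<close>

definition mean_slope :: "real \<Rightarrow> real \<Rightarrow> real \<Rightarrow> real" where
  "mean_slope r a b = integral {0..1} (\<lambda>t. Vx r (b + t * (a - b)))"

lemma mean_slope_same [simp]: "mean_slope r a a = Vx r a"
  by (simp add: mean_slope_def)

lemma integrable_mean_slope: "(\<lambda>t. Vx r (b + t * (a - b))) integrable_on {0..1}"
  by (intro integrable_continuous_interval continuous_on_binary_compose[OF cont_Vx] continuous_intros)

lemma V_diff: "V r a - V r b = mean_slope r a b * (a - b)"
proof -
  have "((\<lambda>t. Vx r (b + t * (a - b)) * (a - b)) has_integral
      V r (b + 1 * (a - b)) - V r (b + 0 * (a - b))) {0..1}"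
  proof (rule fundamental_theorem_of_calculus)
    fix t :: real
    have "((\<lambda>t. V r (b + t * (a - b))) has_real_derivative Vx r (b + t * (a - b)) * (a - b)) (at t)"
      using V_x[of r "b + t * (a - b)"]
      by (rule DERIV_chain2[where g="\<lambda>t. b + t * (a - b)"]) (auto intro!: derivative_eq_intros)
    thus "((\<lambda>t. V r (b + t * (a - b))) has_vector_derivative Vx r (b + t * (a - b)) * (a - b)) (at t within {0..1})"
      by (simp add: has_real_derivative_iff_has_vector_derivative[symmetric] has_field_derivative_at_within)
  qed simp
  from integral_unique[OF this] show ?thesis by (simp add: mean_slope_def)
qed

lemma mean_slope_bound:
  assumes "r \<in> {-1..2}"
  shows "\<bar>mean_slope r a b\<bar> \<le> L"
proof -
  have "norm (mean_slope r a b) \<le> integral {0..1} (\<lambda>t::real. L)"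
    unfolding mean_slope_def
    by (rule integral_norm_bound_integral) (use integrable_mean_slope Vx_bound assms in auto)
  thus ?thesis by simp
qed

lemma continuous_on_mean_slope:
  assumes "continuous_on S p" "continuous_on S a" "continuous_on S b"
  shows "continuous_on S (\<lambda>z. mean_slope (p z) (a z) (b z))"
proof -
  have *: "continuous_on (S \<times> cbox 0 1) (\<lambda>w. h (fst w))" if "continuous_on S h" for h :: "'a \<Rightarrow> real"
    by (rule continuous_on_compose2[OF that]) (auto intro!: continuous_intros)
  have "continuous_on S (\<lambda>z. integral (cbox 0 1) (\<lambda>t. Vx (p z) (b z + t * (a z - b z))))"
    by (rule integral_continuous_on_param, unfold split_beta)
       (intro continuous_on_binary_compose[OF cont_Vx] continuous_intros * assms)
  thus ?thesis by (simp add: mean_slope_def)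
qed

section \<open>Existence by Picard iteration on bounded continuous functions\<close>

definition clamp :: "real \<Rightarrow> real" where
  "clamp s = max (-1) (min 2 s)"

lemma clamp_in: "clamp s \<in> {-1..2}" and clamp_id: "s \<in> {-1..2} \<Longrightarrow> clamp s = s"
  and clamp_clamp: "clamp (clamp s) = clamp s"
  by (auto simp: clamp_def)

lemma continuous_on_clamp: "continuous_on S clamp"
  unfolding clamp_def[abs_def] by (intro continuous_intros)

lemma continuous_on_V_compose:
  "continuous_on S u \<Longrightarrow> continuous_on S (\<lambda>r. V r (u r))"
  by (intro continuous_on_binary_compose[OF cont_V] continuous_intros)

lemma L_nonneg: "0 \<le> L"
  using Vx_bound[of 0 0] by auto

lemma signed_integral_bound_2:
  assumes "continuous_on UNIV f" "s \<in> {-1..2}" "\<And>r. r \<in> {-1..2} \<Longrightarrow> \<bar>f r\<bar> \<le> C"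
  shows "\<bar>signed_integral f s\<bar> \<le> 2 * C"
proof -
  have "\<bar>signed_integral f s\<bar> \<le> \<bar>s\<bar> * C"
    by (rule signed_integral_bound[where S="{-1..2}"]) (use assms in auto)
  also have "\<dots> \<le> 2 * C"
    using assms(2) assms(3)[of 0] by (intro mult_right_mono) auto
  finally show ?thesis .
qed

text \<open>Elements of the space of bounded continuous functions are defined on the entire line,
  but the bounds on \<open>V\<close> hold only for times in \<open>[-1, 2]\<close>. Freezing the
  image outside that interval by \<open>clamp\<close> keeps it bounded and makes the contraction
  estimate uniform.\<close>

definition picard :: "real \<Rightarrow> (real \<Rightarrow>\<^sub>C real) \<Rightarrow> (real \<Rightarrow>\<^sub>C real)" where
  "picard x u = Bcontfun (\<lambda>s. x + signed_integral (\<lambda>r. V r (apply_bcontfun u r)) (clamp s))"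

lemma picard_apply:
  "apply_bcontfun (picard x u) s = x + signed_integral (\<lambda>r. V r (apply_bcontfun u r)) (clamp s)"
proof -
  have c: "continuous_on UNIV (\<lambda>r. V r (apply_bcontfun u r))"
    by (intro continuous_on_V_compose continuous_on_apply_bcontfun)
  have "continuous_on UNIV (signed_integral (\<lambda>r. V r (apply_bcontfun u r)))"
    using signed_integral_has_derivative[OF c] by (intro DERIV_continuous_on) blast
  hence "continuous_on UNIV (\<lambda>s. x + signed_integral (\<lambda>r. V r (apply_bcontfun u r)) (clamp s))"
    by (intro continuous_intros continuous_on_compose2[OF _ continuous_on_clamp]) auto
  moreover have "norm (x + signed_integral (\<lambda>r. V r (apply_bcontfun u r)) (clamp s)) \<le> \<bar>x\<bar> + 2 * B" for s
    using signed_integral_bound_2[OF c clamp_in[of s] V_bound]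
    by (simp add: abs_le_iff abs_if split: if_splits)
  ultimately have "(\<lambda>s. x + signed_integral (\<lambda>r. V r (apply_bcontfun u r)) (clamp s)) \<in> bcontfun"
    by (rule bcontfun_normI)
  thus ?thesis by (simp add: picard_def Bcontfun_inverse)
qed

text \<open>Times in \<open>[-1, 2]\<close> have modulus at most \<open>2\<close>, so the Lipschitz
  constant \<open>1/4\<close> of \<open>V\<close> gives the factor \<open>1/2\<close>. This is the
  reason for requiring \<open>L \<le> 1/4\<close>.\<close>

lemma picard_contraction: "dist (picard x u) (picard x v) \<le> 1/2 * dist u v"
proof (rule dist_bound)
  fix s
  have c: "continuous_on UNIV (\<lambda>r. V r (apply_bcontfun u r))" for u
    by (intro continuous_on_V_compose continuous_on_apply_bcontfun)
  have "\<bar>V r (apply_bcontfun u r) - V r (apply_bcontfun v r)\<bar> \<le> 1/4 * dist u v" if "r \<in> {-1..2}" for r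
  proof -
    have "\<bar>V r (apply_bcontfun u r) - V r (apply_bcontfun v r)\<bar>
        = \<bar>mean_slope r (apply_bcontfun u r) (apply_bcontfun v r)\<bar> * dist (apply_bcontfun u r) (apply_bcontfun v r)"
      by (simp add: V_diff abs_mult dist_real_def)
    also have "\<dots> \<le> 1/4 * dist u v"
      by (intro mult_mono dist_bounded order_trans[OF mean_slope_bound[OF that] L_small]) auto
    finally show ?thesis .
  qed
  hence "\<bar>signed_integral (\<lambda>r. V r (apply_bcontfun u r) - V r (apply_bcontfun v r)) (clamp s)\<bar>
      \<le> 2 * (1/4 * dist u v)"
    by (intro signed_integral_bound_2 continuous_intros c clamp_in)
  thus "dist (apply_bcontfun (picard x u) s) (apply_bcontfun (picard x v) s) \<le> 1/2 * dist u v"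
    by (simp add: picard_apply dist_real_def signed_integral_diff[OF c c])
qed

definition \<xi> :: "real \<Rightarrow> real \<Rightarrow> real" where
  "\<xi> s x = apply_bcontfun (THE u. picard x u = u) s"

lemma \<xi>_eq_clamp: "\<xi> s x = x + signed_integral (\<lambda>r. V r (\<xi> r x)) (clamp s)"
proof -
  have "\<exists>!u. picard x u = u"
    by (rule banach_fix_type[of "1/2"]) (use picard_contraction in auto)
  from theI'[OF this] have "apply_bcontfun (picard x (THE u. picard x u = u)) s = \<xi> s x"
    by (simp add: \<xi>_def)
  thus ?thesis unfolding picard_apply \<xi>_def[symmetric] by simp
qed

lemma \<xi>_clamp: "\<xi> (clamp s) x = \<xi> s x"
  by (subst (1 2) \<xi>_eq_clamp) (simp add: clamp_clamp)

lemma \<xi>_eq: "s \<in> {-1..2} \<Longrightarrow> \<xi> s x = x + signed_integral (\<lambda>r. V r (\<xi> r x)) s"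
  using \<xi>_eq_clamp[of s x] by (simp add: clamp_id)

lemma \<xi>_0 [simp]: "\<xi> 0 x = x"
  by (simp add: \<xi>_eq)

lemma continuous_on_\<xi>_time: "continuous_on S (\<lambda>s. \<xi> s x)"
  by (simp add: \<xi>_def)

lemma \<xi>_time_derivative_within:
  assumes "s \<in> {-1..2}"
  shows "((\<lambda>s. \<xi> s x) has_real_derivative V s (\<xi> s x)) (at s within {-1..2})"
proof (rule has_field_derivative_transform_within[where d=1])
  show "((\<lambda>s. x + signed_integral (\<lambda>r. V r (\<xi> r x)) s) has_real_derivative V s (\<xi> s x)) (at s within {-1..2})"
    using has_field_derivative_at_within[OF signed_integral_has_derivative[OF
        continuous_on_V_compose[OF continuous_on_\<xi>_time]], of x s "{-1..2}"]
    by (auto intro!: derivative_eq_intros)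
qed (use assms \<xi>_eq in auto)

lemma \<xi>_time_derivative:
  assumes "s \<in> {-1<..<2}"
  shows "((\<lambda>s. \<xi> s x) has_real_derivative V s (\<xi> s x)) (at s)"
proof -
  have "((\<lambda>s. \<xi> s x) has_real_derivative V s (\<xi> s x)) (at s within {-1<..<2})"
    by (rule has_field_derivative_subset[OF \<xi>_time_derivative_within]) (use assms in auto)
  thus ?thesis using assms by (simp add: at_within_open_NO_MATCH)
qed

lemma continuous_on_mean_slope_\<xi>: "continuous_on S (\<lambda>r. mean_slope r (\<xi> r x) (\<xi> r y))"
  by (intro continuous_on_mean_slope continuous_on_\<xi>_time continuous_intros)

text \<open>The difference of two scalar solutions solves a linear equation; this yields at once
  uniqueness, monotonicity, and the derivative with respect to the initial value.\<close>

lemma \<xi>_diff: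
  assumes "s \<in> {-1..2}"
  shows "\<xi> s x - \<xi> s y = exp (signed_integral (\<lambda>r. mean_slope r (\<xi> r x) (\<xi> r y)) s) * (x - y)"
proof -
  have "\<xi> s x - \<xi> s y = (\<xi> 0 x - \<xi> 0 y) * exp (signed_integral (\<lambda>r. mean_slope r (\<xi> r x) (\<xi> r y)) s)"
  proof (rule linear_ode_solution[where S="{-1..2}"])
    fix r :: real assume "r \<in> {-1..2}"
    from Deriv.field_differentiable_diff[OF \<xi>_time_derivative_within[OF this, of x] \<xi>_time_derivative_within[OF this, of y]]
    show "((\<lambda>s. \<xi> s x - \<xi> s y) has_real_derivative mean_slope r (\<xi> r x) (\<xi> r y) * (\<xi> r x - \<xi> r y))
        (at r within {-1..2})"
      by (simp add: V_diff)
  qed (use assms continuous_on_mean_slope_\<xi> in auto)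
  thus ?thesis by simp
qed

text \<open>The constant \<open>x\<close> solves the same equation, so the difference solves a
  linear one with initial value zero.\<close>

lemma \<xi>_stationary:
  assumes "\<And>s. V s x = 0" "s \<in> {-1..2}"
  shows "\<xi> s x = x"
proof -
  have "\<xi> s x - x = (\<xi> 0 x - x) * exp (signed_integral (\<lambda>r. mean_slope r (\<xi> r x) x) s)"
  proof (rule linear_ode_solution[where S="{-1..2}"])
    fix r :: real assume "r \<in> {-1..2}"
    from Deriv.field_differentiable_diff[OF \<xi>_time_derivative_within[OF this, of x] DERIV_const[of x]]
    show "((\<lambda>s. \<xi> s x - x) has_real_derivative mean_slope r (\<xi> r x) x * (\<xi> r x - x))
        (at r within {-1..2})"
      using V_diff[of r "\<xi> r x" x] assms(1)[of r] by simp
  qed (use assms(2) in \<open>auto intro!: continuous_on_mean_slope continuous_on_\<xi>_time continuous_intros\<close>)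
  thus ?thesis by simp
qed

lemma \<xi>_displacement:
  assumes "s \<in> {-1..2}"
  shows "\<bar>\<xi> s x - x\<bar> \<le> 2 * B"
proof -
  have "\<xi> s x - x = signed_integral (\<lambda>r. V r (\<xi> r x)) s"
    using \<xi>_eq[OF assms] by simp
  thus ?thesis
    by (auto intro!: signed_integral_bound_2 continuous_on_V_compose continuous_on_\<xi>_time V_bound assms
        simp del: atLeastAtMost_iff)
qed

lemma \<xi>_lipschitz: "\<bar>\<xi> s x - \<xi> s y\<bar> \<le> 2 * \<bar>x - y\<bar>"
proof -
  have "\<bar>signed_integral (\<lambda>r. mean_slope r (\<xi> r x) (\<xi> r y)) (clamp s)\<bar> \<le> 2 * L"
    by (intro signed_integral_bound_2 continuous_on_mean_slope_\<xi> clamp_in mean_slope_bound)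
  hence "norm (signed_integral (\<lambda>r. mean_slope r (\<xi> r x) (\<xi> r y)) (clamp s)) \<le> 1/2"
    using L_small by simp
  from exp_bound_half[OF this]
  have "exp (signed_integral (\<lambda>r. mean_slope r (\<xi> r x) (\<xi> r y)) (clamp s)) * \<bar>x - y\<bar> \<le> 2 * \<bar>x - y\<bar>"
    by (intro mult_right_mono) auto
  thus ?thesis
    using \<xi>_diff[OF clamp_in, of s x y] by (simp add: abs_mult \<xi>_clamp)
qed

text \<open>Continuity in time for fixed \<open>x\<close>, combined with a Lipschitz bound in
  \<open>x\<close> that is uniform in time.\<close>

lemma continuous_on_\<xi>: "continuous_on UNIV (\<lambda>(s, x). \<xi> s x)"
proof -
  have "isCont (\<lambda>(s, x). \<xi> s x) (s, x)" for s x
  proof -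
    have "isCont (\<lambda>r. \<xi> r x) s"
      using continuous_on_\<xi>_time[of UNIV x] by (simp add: continuous_on_eq_continuous_at)
    hence "isCont (\<lambda>z. \<xi> (fst z) x) (s, x)"
      using isCont_o2[of "(s, x)" fst "\<lambda>r. \<xi> r x"] isCont_fst[OF continuous_ident, of "(s, x)"] by simp
    hence "((\<lambda>z. \<xi> (fst z) x) \<longlongrightarrow> \<xi> s x) (at (s, x))" by (simp add: isCont_def)
    moreover have "((\<lambda>z. snd z) \<longlongrightarrow> x) (at (s, x))"
      using isCont_snd[OF continuous_ident, of "(s, x)"] by (simp add: isCont_def)
    ultimately have "((\<lambda>z. 2 * \<bar>snd z - x\<bar> + \<bar>\<xi> (fst z) x - \<xi> s x\<bar>) \<longlongrightarrow> 2 * \<bar>x - x\<bar> + \<bar>\<xi> s x - \<xi> s x\<bar>) (at (s, x))"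
      by (intro tendsto_intros)
    hence lim: "((\<lambda>z. 2 * \<bar>snd z - x\<bar> + \<bar>\<xi> (fst z) x - \<xi> s x\<bar>) \<longlongrightarrow> 0) (at (s, x))"
      by simp
    have "norm ((case z of (s, x) \<Rightarrow> \<xi> s x) - \<xi> s x) \<le> 2 * \<bar>snd z - x\<bar> + \<bar>\<xi> (fst z) x - \<xi> s x\<bar>" for z
      using \<xi>_lipschitz[of "fst z" "snd z" x] unfolding split_beta by simp
    hence "((\<lambda>z. (case z of (s, x) \<Rightarrow> \<xi> s x) - \<xi> s x) \<longlongrightarrow> 0) (at (s, x))"
      by (intro Lim_null_comparison[OF always_eventually lim] allI)
    from LIM_zero_cancel[OF this] show ?thesis by (simp add: isCont_def)
  qed
  thus ?thesis unfolding continuous_on_eq_continuous_at[OF open_UNIV] by fast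
qed

section \<open>Differentiability in the initial value and joint C2 regularity\<close>

definition J :: "real \<Rightarrow> real \<Rightarrow> real" where
  "J s x = exp (signed_integral (\<lambda>r. Vx r (\<xi> r x)) s)"

text \<open>\<open>\<xi>_diff\<close> is already the Caratheodory form of differentiability: its
  exponential factor is the slope function. It remains to see that this factor is continuous in the
  varying initial value; on the diagonal it is \<open>J\<close>.\<close>

lemma \<xi>_space_derivative:
  assumes s: "s \<in> {-1..2}"
  shows "(\<xi> s has_real_derivative J s x) (at x)"
  unfolding CARAT_DERIV
proof (intro exI conjI allI)
  let ?g = "\<lambda>z. exp (signed_integral (\<lambda>r. mean_slope r (\<xi> r z) (\<xi> r x)) s)"
  show "\<xi> s z - \<xi> s x = ?g z * (z - x)" for z
    by (rule \<xi>_diff[OF s])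
  have "continuous_on UNIV (\<lambda>z. signed_integral (\<lambda>r. mean_slope r (\<xi> r z) (\<xi> r x)) s)"
    by (rule continuous_on_binary_compose[where f="\<lambda>s z. signed_integral (\<lambda>r. mean_slope r (\<xi> r z) (\<xi> r x)) s"])
      (intro continuous_on_signed_integral_param continuous_on_mean_slope continuous_intros, unfold split_beta,
        (intro continuous_on_mean_slope continuous_on_binary_compose[OF continuous_on_\<xi>] continuous_intros)+)
  hence "continuous_on UNIV ?g" by (intro continuous_intros)
  thus "isCont ?g x" by (simp add: continuous_on_eq_continuous_at)
  show "?g x = J s x" by (simp add: J_def)
qed

lemma continuous_on_slope_along: "continuous_on UNIV (\<lambda>(r, x). Vx r (\<xi> r x))"
  unfolding split_beta
  by (intro continuous_on_binary_compose[OF cont_Vx] continuous_on_binary_compose[OF continuous_on_\<xi>] continuous_intros)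

lemma continuous_on_slope_along_time: "continuous_on UNIV (\<lambda>r. Vx r (\<xi> r x))"
  by (intro continuous_on_binary_compose[OF cont_Vx] continuous_on_\<xi>_time continuous_intros)

text \<open>The exponent has modulus at most \<open>2 * L \<le> 1/2\<close>, and there
  \<open>exp z\<close> lies between \<open>1 + z\<close> and
  \<open>1 + 2 * \<bar>z\<bar>\<close>.\<close>

lemma J_bound:
  assumes "s \<in> {-1..2}"
  shows "\<bar>J s x - 1\<bar> \<le> 4 * L"
proof -
  let ?z = "signed_integral (\<lambda>r. Vx r (\<xi> r x)) s"
  have z: "\<bar>?z\<bar> \<le> 2 * L"
    by (intro signed_integral_bound_2 continuous_on_slope_along_time assms Vx_bound)
  hence "exp ?z \<le> 1 + 2 * \<bar>?z\<bar>"
    using exp_bound_lemma[of ?z] L_small by simp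
  moreover have "1 + ?z \<le> exp ?z" by (rule exp_ge_add_one_self)
  moreover have "- (2 * L) \<le> ?z" using z unfolding abs_le_iff by linarith
  ultimately have "exp ?z - 1 \<le> 4 * L" "1 - exp ?z \<le> 4 * L"
    using z L_nonneg by linarith+
  thus ?thesis unfolding J_def by (simp only: abs_le_iff minus_diff_eq conj_commute)
qed

lemma continuous_on_J: "continuous_on UNIV (\<lambda>(s, x). J s x)"
  unfolding J_def split_beta
  by (intro continuous_intros continuous_on_binary_compose[OF continuous_on_signed_integral_param
        [of "\<lambda>x r. Vx r (\<xi> r x)", OF continuous_on_slope_along]])

lemma J_time_derivative: "((\<lambda>s. J s x) has_real_derivative J s x * Vx s (\<xi> s x)) (at s)"
  unfolding J_def
  by (intro DERIV_chain2[OF DERIV_exp] signed_integral_has_derivative continuous_on_slope_along_time)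

lemma continuous_on_Vxx_J: "continuous_on UNIV (\<lambda>(r, x). Vxx r (\<xi> r x) * J r x)"
  unfolding split_beta
  by (intro continuous_on_binary_compose[OF cont_Vxx] continuous_on_binary_compose[OF continuous_on_\<xi>]
      continuous_on_binary_compose[OF continuous_on_J] continuous_intros)

lemma J_space_derivative:
  assumes "s \<in> {-1..2}"
  shows "(J s has_real_derivative J s x * signed_integral (\<lambda>r. Vxx r (\<xi> r x) * J r x) s) (at x)"
proof -
  have "((\<lambda>x. signed_integral (\<lambda>r. Vx r (\<xi> r x)) s) has_real_derivative
      signed_integral (\<lambda>r. Vxx r (\<xi> r x) * J r x) s) (at x)"
    by (rule signed_integral_param_has_derivative[where S="{-1..2}", OF continuous_on_slope_along continuous_on_Vxx_J])
       (use assms in \<open>auto intro!: DERIV_chain2[OF V_xx \<xi>_space_derivative]\<close>)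
  thus ?thesis
    unfolding J_def[abs_def] by (intro DERIV_chain2[OF DERIV_exp])
qed

text \<open>A bootstrap. The partial derivatives of \<open>\<xi>\<close> are \<open>V\<close> along
  the solution and \<open>J\<close>. Both are continuous, so \<open>\<xi>\<close> is C1, which makes
  the first of them C1; the second is C1 because its own partial derivatives are explicit and
  continuous.\<close>

lemma C2_open_\<xi>: "C2_open ({-1<..<2} \<times> UNIV) (\<lambda>(s, x). \<xi> s x)"
proof (rule C2_open_partials)
  have ct: "continuous_on ({-1<..<2} \<times> UNIV) (\<lambda>(s, x). V s (\<xi> s x))"
    unfolding split_beta
    by (intro continuous_on_binary_compose[OF cont_V] continuous_on_binary_compose[OF continuous_on_\<xi>] continuous_intros)
  have "C1_open ({-1<..<2} \<times> UNIV) (\<lambda>(s, x). \<xi> s x)"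
    by (rule C1_open_partials[OF _ \<xi>_time_derivative \<xi>_space_derivative ct continuous_on_subset[OF continuous_on_J]]) auto
  hence c: "C1_open ({-1<..<2} \<times> UNIV) (\<lambda>z. (fst z, \<xi> (fst z) (snd z)))"
    unfolding split_beta by (rule C1_open_Pair[OF C1_open_linear[OF bounded_linear_fst]])
  have "C1_open (UNIV \<times> UNIV) (\<lambda>(s, x). V s x)"
    by (rule C1_open_partials[OF _ V_s V_x]) (use cont_Vs cont_Vx in auto)
  from C1_open_compose[OF this c] show "C1_open ({-1<..<2} \<times> UNIV) (\<lambda>(s, x). V s (\<xi> s x))"
    unfolding split_beta by simp
  have "continuous_on UNIV (\<lambda>(s, x). J s x * Vx s (\<xi> s x))"
    "continuous_on UNIV (\<lambda>(s, x). J s x * signed_integral (\<lambda>r. Vxx r (\<xi> r x) * J r x) s)"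
    unfolding split_beta
    by (intro continuous_on_binary_compose[OF cont_Vx] continuous_on_binary_compose[OF continuous_on_\<xi>]
      continuous_on_binary_compose[OF continuous_on_J] continuous_intros
      continuous_on_binary_compose[OF continuous_on_signed_integral_param
        [of "\<lambda>x r. Vxx r (\<xi> r x) * J r x", OF continuous_on_Vxx_J]])+
  thus "C1_open ({-1<..<2} \<times> UNIV) (\<lambda>(s, x). J s x)"
    by (intro C1_open_partials[OF _ J_time_derivative J_space_derivative])
       (auto intro: continuous_on_subset)
qed (use \<xi>_time_derivative \<xi>_space_derivative in auto)

end

section \<open>The perturbation and the cut-off\<close>

text \<open>The difference quotients of \<open>f\<close> are squeezed by those of \<open>g\<close>.
  This handles the points where two branches of a piecewise function meet.\<close>

lemma DERIV_zero_dominated: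
  fixes f g :: "real \<Rightarrow> real"
  assumes g: "(g has_real_derivative 0) (at x)" "g x = 0"
    and le: "\<And>y. \<bar>f y\<bar> \<le> \<bar>g y\<bar>"
  shows "(f has_real_derivative 0) (at x)"
proof -
  have "f x = 0" using le[of x] g(2) by simp
  have lim: "((\<lambda>h. \<bar>(g (x + h) - g x) / h\<bar>) \<longlongrightarrow> 0) (at 0)"
    using tendsto_rabs_zero g(1) unfolding DERIV_def by blast
  have "norm ((f (x + h) - f x) / h) \<le> \<bar>(g (x + h) - g x) / h\<bar>" for h
    using le[of "x + h"] \<open>f x = 0\<close> g(2) by (simp add: abs_divide divide_right_mono)
  thus ?thesis unfolding DERIV_def
    by (intro Lim_null_comparison[OF always_eventually lim] allI)
qed

lemma continuous_on_Icc_bounded: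
  fixes g :: "real \<Rightarrow> real"
  assumes "continuous_on {u..v} g"
  shows "\<exists>C. \<forall>x\<in>{u..v}. \<bar>g x\<bar> \<le> C"
  using compact_imp_bounded[OF compact_continuous_image[OF assms compact_Icc]] by (force simp: bounded_iff)

section \<open>The extended polynomial and its norm\<close>

lemma phi_ext_eq_0:
  assumes "poly p a = 0" "poly p b = 0" "x \<notin> {a<..<b}"
  shows "phi_ext a b p x = 0"
  using assms by (cases "x = a \<or> x = b") (auto simp: phi_ext_def)

text \<open>At an endpoint the extension is dominated by the polynomial itself, whose value and
  derivative vanish there. Applied to successive derivatives it climbs one order at a time.\<close>

lemma DERIV_phi_ext:
  assumes "poly p a = 0" "poly p b = 0" "poly (pderiv p) a = 0" "poly (pderiv p) b = 0"
  shows "(phi_ext a b p has_real_derivative phi_ext a b (pderiv p) x) (at x)"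
proof -
  consider "x \<in> {a<..<b}" | "x = a \<or> x = b" | "x \<in> - {a..b}"
    by fastforce
  thus ?thesis
  proof cases
    case 1
    have "(phi_ext a b p has_real_derivative poly (pderiv p) x) (at x)"
      by (rule has_field_derivative_transform_within_open[OF poly_DERIV, where S="{a<..<b}"])
         (use 1 in \<open>auto simp: phi_ext_def\<close>)
    thus ?thesis using 1 by (simp add: phi_ext_def)
  next
    case 2
    have "(phi_ext a b p has_real_derivative 0) (at x)"
      by (rule DERIV_zero_dominated[of "poly p"])
         (use 2 assms poly_DERIV[of p x] in \<open>auto simp: phi_ext_def simp del: poly_DERIV\<close>)
    thus ?thesis using 2 assms by (auto simp: phi_ext_def)
  next
    case 3
    have "(phi_ext a b p has_real_derivative 0) (at x)"
      by (rule has_field_derivative_transform_within_open[OF DERIV_const[of 0], where S="- {a..b}"])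
         (use 3 in \<open>auto simp: phi_ext_def open_Compl\<close>)
    thus ?thesis using 3 by (auto simp: phi_ext_def)
  qed
qed

lemma continuous_on_phi_ext:
  assumes "poly p a = 0" "poly p b = 0" "a < b"
  shows "continuous_on S (phi_ext a b p)"
proof -
  \<comment> \<open>As \<open>p\<close> vanishes at both ends, the extension is \<open>p\<close>
    evaluated at the nearest point of \<open>[a, b]\<close>.\<close>
  have "phi_ext a b p = (\<lambda>x. poly p (max a (min b x)))"
    using assms by (auto simp: phi_ext_def fun_eq_iff max_def min_def)
  thus ?thesis by (auto intro!: continuous_intros)
qed

lemma bdd_above_phi_ext: "bdd_above ((\<lambda>x. \<bar>phi_ext a b p x\<bar>) ` {a<..<b})"
proof -
  obtain C where "\<forall>x\<in>{a..b}. \<bar>poly p x\<bar> \<le> C"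
    using continuous_on_Icc_bounded[OF continuous_on_poly[OF continuous_on_id]] by blast
  thus ?thesis by (intro bdd_aboveI2[of _ _ C]) (auto simp: phi_ext_def)
qed

text \<open>A polynomial is Lipschitz on \<open>[a, b]\<close>, and the surplus factor
  \<open>\<bar>x - y\<bar> powr (1 - \<alpha>)\<close> is bounded by a power of
  \<open>b - a\<close>. Boundedness has to be known before a real \<open>SUP\<close> says anything
  about its members.\<close>

lemma bdd_above_phi_ext_Hoelder:
  assumes \<alpha>: "0 < \<alpha>" "\<alpha> < 1"
  shows "bdd_above ((\<lambda>z. \<bar>phi_ext a b p (fst z) - phi_ext a b p (snd z)\<bar> / \<bar>fst z - snd z\<bar> powr \<alpha>)
    ` {(x, y). x \<in> {a<..<b} \<and> y \<in> {a<..<b} \<and> x \<noteq> y})"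
proof -
  obtain C where "\<forall>x\<in>{a..b}. \<bar>poly (pderiv p) x\<bar> \<le> C"
    using continuous_on_Icc_bounded[OF continuous_on_poly[OF continuous_on_id]] by blast
  hence C: "\<bar>poly (pderiv p) x\<bar> \<le> C" if "x \<in> {a..b}" for x
    using that by blast
  show ?thesis
  proof (rule bdd_aboveI2, clarsimp)
    fix x y assume xy: "a < x" "x < b" "a < y" "y < b" "x \<noteq> y"
    have "0 \<le> C" using C[of x] xy by auto
    have "norm (poly p x - poly p y) \<le> C * norm (x - y)"
      by (rule field_differentiable_bound[where S="{a..b}" and f'="poly (pderiv p)"])
         (use C xy in \<open>auto intro: has_field_derivative_at_within poly_DERIV\<close>)
    hence "\<bar>poly p x - poly p y\<bar> \<le> C * (\<bar>x - y\<bar> powr (1 - \<alpha>) * \<bar>x - y\<bar> powr \<alpha>)"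
      using xy by (simp add: powr_add[symmetric])
    also have "\<dots> \<le> C * ((b - a) powr (1 - \<alpha>) * \<bar>x - y\<bar> powr \<alpha>)"
      using xy \<alpha> \<open>0 \<le> C\<close> by (intro mult_left_mono mult_right_mono powr_mono2) auto
    finally show "\<bar>phi_ext a b p x - phi_ext a b p y\<bar> / \<bar>x - y\<bar> powr \<alpha> \<le> C * (b - a) powr (1 - \<alpha>)"
      using xy by (simp add: phi_ext_def field_simps)
  qed
qed

lemma phi_ext_le_SUP:
  assumes "poly p a = 0" "poly p b = 0" "a < b"
  shows "\<bar>phi_ext a b p x\<bar> \<le> (SUP x\<in>{a<..<b}. \<bar>phi_ext a b p x\<bar>)"
proof -
  have *: "\<bar>phi_ext a b p x\<bar> \<le> (SUP x\<in>{a<..<b}. \<bar>phi_ext a b p x\<bar>)" if "x \<in> {a<..<b}" for x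
    by (rule cSUP_upper[OF that bdd_above_phi_ext])
  show ?thesis
  proof (cases "x \<in> {a<..<b}")
    case False
    \<comment> \<open>Outside the interval the value is zero; the midpoint serves to show that the
      supremum is nonnegative.\<close>
    thus ?thesis using *[of "(a + b) / 2"] assms by (simp add: phi_ext_eq_0)
  qed (use * in auto)
qed

text \<open>Each of the four suprema is nonnegative, so each is at most their sum; the Hoelder
  seminorm enters through its sign.\<close>

lemma C2alpha_norm_phi_ext:
  assumes p: "\<forall>k\<le>3. poly ((pderiv ^^ k) p) a = 0 \<and> poly ((pderiv ^^ k) p) b = 0"
    and ab: "a < b" and \<alpha>: "0 < \<alpha>" "\<alpha> < 1"
    and small: "C2alpha_norm \<alpha> a b (phi_ext a b p) < \<epsilon>" and k: "k \<le> 2"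
  shows "\<bar>phi_ext a b ((pderiv ^^ k) p) x\<bar> \<le> \<epsilon>"
proof -
  have z: "poly ((pderiv ^^ k) p) a = 0" "poly ((pderiv ^^ k) p) b = 0" if "k \<le> 3" for k
    using p that by auto
  note z0 = z[of 0, simplified] and z1 = z[of 1, simplified]
    and z2 = z[of 2, simplified numeral_2_eq_2, simplified]
    and z3 = z[of 3, simplified numeral_3_eq_3, simplified]
  have d1: "deriv (phi_ext a b p) = phi_ext a b (pderiv p)"
    using DERIV_imp_deriv[OF DERIV_phi_ext] z0 z1 by (simp add: fun_eq_iff)
  have d2: "(deriv ^^ 2) (phi_ext a b p) = phi_ext a b (pderiv (pderiv p))"
    using DERIV_imp_deriv[OF DERIV_phi_ext[OF z1 z2]] d1 by (auto simp: numeral_2_eq_2)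
  have "0 \<le> \<bar>phi_ext a b (pderiv (pderiv p)) (fst z) - phi_ext a b (pderiv (pderiv p)) (snd z)\<bar>
      / \<bar>fst z - snd z\<bar> powr \<alpha>" for z
    by simp
  \<comment> \<open>The points that divide \<open>(a, b)\<close> into thirds are two distinct
    members, so the index set of the seminorm is nonempty.\<close>
  also have "\<dots> z \<le> (SUP z\<in>{(x, y). x \<in> {a<..<b} \<and> y \<in> {a<..<b} \<and> x \<noteq> y}.
      \<bar>phi_ext a b (pderiv (pderiv p)) (fst z) - phi_ext a b (pderiv (pderiv p)) (snd z)\<bar>
      / \<bar>fst z - snd z\<bar> powr \<alpha>)" if "z = ((2 * a + b) / 3, (a + 2 * b) / 3)" for z
    by (rule cSUP_upper[OF _ bdd_above_phi_ext_Hoelder[OF \<alpha>]]) (use ab that in auto)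
  finally have "0 \<le> (SUP z\<in>{(x, y). x \<in> {a<..<b} \<and> y \<in> {a<..<b} \<and> x \<noteq> y}.
      \<bar>phi_ext a b (pderiv (pderiv p)) (fst z) - phi_ext a b (pderiv (pderiv p)) (snd z)\<bar>
      / \<bar>fst z - snd z\<bar> powr \<alpha>)"
    by blast
  moreover have "0 \<le> (SUP x\<in>{a<..<b}. \<bar>phi_ext a b p x\<bar>)"
    "0 \<le> (SUP x\<in>{a<..<b}. \<bar>phi_ext a b (pderiv p) x\<bar>)"
    "0 \<le> (SUP x\<in>{a<..<b}. \<bar>phi_ext a b (pderiv (pderiv p)) x\<bar>)"
    using order_trans[OF abs_ge_zero phi_ext_le_SUP] z0 z1 z2 ab by blast+
  ultimately have le:
    "(SUP x\<in>{a<..<b}. \<bar>phi_ext a b p x\<bar>) \<le> \<epsilon>"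
    "(SUP x\<in>{a<..<b}. \<bar>phi_ext a b (pderiv p) x\<bar>) \<le> \<epsilon>"
    "(SUP x\<in>{a<..<b}. \<bar>phi_ext a b (pderiv (pderiv p)) x\<bar>) \<le> \<epsilon>"
    using small unfolding C2alpha_norm_def d1 d2 by linarith+
  consider "k = 0" | "k = 1" | "k = 2" using k by linarith
  thus ?thesis
    using le order_trans[OF phi_ext_le_SUP[OF z0 ab]] order_trans[OF phi_ext_le_SUP[OF z1 ab]]
      order_trans[OF phi_ext_le_SUP[OF z2 ab]]
    by cases (auto simp: numeral_2_eq_2)
qed

section \<open>The cut-off function\<close>

lemma DERIV_max_0_power:
  "((\<lambda>t. max 0 t ^ Suc (Suc n)) has_real_derivative real (Suc (Suc n)) * max 0 t ^ Suc n) (at t)"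
proof -
  consider "t < 0" | "t = 0" | "t > 0" by linarith
  thus ?thesis
  proof cases
    case 1
    have "((\<lambda>t::real. max 0 t ^ Suc (Suc n)) has_real_derivative 0) (at t)"
      by (rule has_field_derivative_transform_within_open[OF DERIV_const[of 0], where S="{..<0}"])
         (use 1 in auto)
    thus ?thesis using 1 by simp
  next
    case 2
    have "((\<lambda>t::real. max 0 t ^ Suc (Suc n)) has_real_derivative 0) (at 0)"
    proof (rule DERIV_zero_dominated)
      show "((\<lambda>t::real. t ^ Suc (Suc n)) has_real_derivative 0) (at 0)"
        using DERIV_pow[of "Suc (Suc n)" "0::real"] by simp
    qed (auto simp: power_abs max_def)
    thus ?thesis using 2 by simp
  next
    case 3
    have "((\<lambda>t. max 0 t ^ Suc (Suc n)) has_real_derivative real (Suc (Suc n)) * t ^ Suc n) (at t)"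
      by (rule has_field_derivative_transform_within_open[where S="{0<..}" and f="\<lambda>t. t ^ Suc (Suc n)"])
         (use 3 DERIV_pow[of "Suc (Suc n)" t] in auto)
    thus ?thesis using 3 by simp
  qed
qed

text \<open>The cube is the smallest integer power whose positive part is C2; it is the only
  building block of the cut-off besides polynomials.\<close>

lemma C2_open_max_0_cube: "C2_open UNIV (\<lambda>t::real. max 0 t ^ 3)"
proof (rule C2_open_real)
  show "((\<lambda>t. max 0 t ^ 3) has_real_derivative 3 * max 0 x ^ 2) (at x)" for x :: real
    using DERIV_max_0_power[of 1 x] by (simp add: numeral_eq_Suc)
  have "((\<lambda>t. 3 * max 0 t ^ 2) has_real_derivative 3 * (2 * max 0 x)) (at x)" for x :: real
    using DERIV_cmult[OF DERIV_max_0_power[of 0 x], of 3] by (simp add: numeral_eq_Suc)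
  thus "C1_open UNIV (\<lambda>t::real. 3 * max 0 t ^ 2)"
    by (rule C1_open_real) (auto intro!: continuous_intros)
qed

text \<open>With \<open>c\<close> the cube of the positive part, \<open>1 - c (1 - c t)\<close> is
  \<open>0\<close> for \<open>t \<le> 0\<close>, is \<open>1\<close> for \<open>t \<ge> 1\<close>,
  and stays in \<open>[0, 1]\<close>. It is composed with a quadratic \<open>q\<close> that is at
  least \<open>1\<close> on \<open>[m, M]\<close> and nonpositive off
  \<open>[m/2, M+1]\<close>.\<close>

lemma exists_C2_cutoff:
  fixes m M :: real
  assumes "0 < m" "m \<le> M"
  obtains \<eta> \<eta>' :: "real \<Rightarrow> real" and K where
    "C2_open UNIV \<eta>" "\<And>y. (\<eta> has_real_derivative \<eta>' y) (at y)"
    "\<And>y. \<bar>\<eta> y\<bar> \<le> 1" "\<And>y. \<bar>\<eta>' y\<bar> \<le> K"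
    "\<And>y. y \<in> {m..M} \<Longrightarrow> \<eta> y = 1" "\<And>y. y \<notin> {m/2..M+1} \<Longrightarrow> \<eta> y = 0"
proof -
  define c where "c = (\<lambda>t::real. max 0 t ^ 3)"
  \<comment> \<open>On \<open>[m, M]\<close> the first factor is at least \<open>m/2\<close> and the
    second at least \<open>1\<close>, which explains the divisor.\<close>
  define q where "q y = (y - m/2) * (M + 1 - y) / (m/2)" for y
  define \<eta> where "\<eta> y = 1 - c (1 - c (q y))" for y
  have C2_1: "C2_open UNIV (\<lambda>t::real. 1 - t)"
    by (rule C2_open_real[of _ _ "\<lambda>_. -1"]) (auto intro!: derivative_eq_intros C1_open_const)
  have "(q has_real_derivative (M + 1 + m/2 - 2 * y) / (m/2)) (at y)" for y
    unfolding q_def[abs_def] using assms(1) by (auto intro!: derivative_eq_intros)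
  moreover have "C1_open UNIV (\<lambda>y. (M + 1 + m/2 - 2 * y) / (m/2))"
    by (rule C1_open_real[of _ _ "\<lambda>_. -2 / (m/2)"]) (use assms(1) in \<open>auto intro!: derivative_eq_intros\<close>)
  ultimately have C2_q: "C2_open UNIV q" by (rule C2_open_real)
  have C2: "C2_open UNIV \<eta>"
    unfolding \<eta>_def[abs_def] c_def
    by (rule C2_open_compose[OF C2_1], rule C2_open_compose[OF C2_open_max_0_cube], rule C2_open_compose[OF C2_1],
        rule C2_open_compose[OF C2_open_max_0_cube C2_q]) auto
  then obtain D where "\<forall>y\<in>UNIV. (\<eta> has_derivative blinfun_apply (D y)) (at y)" and D': "C1_open UNIV D"
    unfolding C2_open_def by blast
  hence D: "(\<eta> has_derivative blinfun_apply (D y)) (at y)" for y by blast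
  define \<eta>' where "\<eta>' y = blinfun_apply (D y) 1" for y
  have der: "(\<eta> has_real_derivative \<eta>' y) (at y)" for y
  proof -
    have "blinfun_apply (D y) h = h *\<^sub>R \<eta>' y" for h
      unfolding \<eta>'_def by (subst blinfun.scaleR_right[symmetric]) simp
    hence "blinfun_apply (D y) = (*) (\<eta>' y)"
      by (simp add: fun_eq_iff mult.commute)
    thus ?thesis using D[of y] by (simp add: has_field_derivative_def)
  qed
  have zero: "\<eta> y = 0" if "y \<notin> {m/2..M+1}" for y
  proof -
    have "q y \<le> 0"
      using that assms by (auto simp: q_def not_le mult_nonneg_nonpos mult_nonpos_nonneg divide_nonpos_pos)
    thus ?thesis by (simp add: \<eta>_def c_def)
  qed
  have one: "\<eta> y = 1" if "y \<in> {m..M}" for y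
  proof -
    have "m/2 * 1 \<le> (y - m/2) * (M + 1 - y)"
      using that assms by (intro mult_mono) auto
    hence "1 \<le> q y" using assms by (simp add: q_def field_simps)
    hence "1 \<le> c (q y)" by (simp add: c_def)
    thus ?thesis by (simp add: \<eta>_def c_def)
  qed
  have "\<bar>\<eta> y\<bar> \<le> 1" for y
  proof -
    have "0 \<le> c (q y)" by (simp add: c_def)
    hence "0 \<le> c (1 - c (q y))" "c (1 - c (q y)) \<le> 1"
      by (auto simp: c_def max_def intro!: power_le_one)
    thus ?thesis by (simp add: \<eta>_def)
  qed
  \<comment> \<open>The derivative is continuous on a compact interval and zero off it, hence
    bounded on the line.\<close>
  moreover obtain K where K: "\<And>y. \<bar>\<eta>' y\<bar> \<le> K"
  proof -
    have "continuous_on {m/2..M+1} \<eta>'"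
      unfolding \<eta>'_def[abs_def] by (intro continuous_intros continuous_on_subset[OF C1_open_imp_continuous_on[OF D'] subset_UNIV])
    then obtain K where "\<forall>y\<in>{m/2..M+1}. \<bar>\<eta>' y\<bar> \<le> K"
      using continuous_on_Icc_bounded by blast
    hence K: "\<bar>\<eta>' y\<bar> \<le> K" if "y \<in> {m/2..M+1}" for y
      using that by blast
    have "\<eta>' y = 0" if "y \<notin> {m/2..M+1}" for y
    proof (rule DERIV_unique[OF der])
      show "(\<eta> has_real_derivative 0) (at y)"
        by (rule has_field_derivative_transform_within_open[OF DERIV_const[of 0], where S="- {m/2..M+1}"])
           (use that zero in \<open>auto simp: open_Compl\<close>)
    qed
    hence "\<bar>\<eta>' y\<bar> \<le> max K 0" for y
      using K[of y] by (cases "y \<in> {m/2..M+1}") auto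
    thus ?thesis by (rule that)
  qed
  ultimately show ?thesis using that[OF C2 der _ K one zero] by blast
qed

section \<open>The normal flow of a graph\<close>

text \<open>If \<open>(v, p * v + f)\<close> is orthogonal to \<open>(1, p)\<close>, then
  \<open>v = - f * tilt p\<close>.\<close>

definition tilt :: "real \<Rightarrow> real" where "tilt p = p / (1 + p\<^sup>2)"
definition tilt' :: "real \<Rightarrow> real" where "tilt' p = (1 - p\<^sup>2) / (1 + p\<^sup>2)\<^sup>2"
definition tilt'' :: "real \<Rightarrow> real" where "tilt'' p = (2 * p ^ 3 - 6 * p) / (1 + p\<^sup>2) ^ 3"

lemma one_plus_square_nz: "1 + p\<^sup>2 \<noteq> (0::real)"
  by (metis add_pos_nonneg less_irrefl zero_le_power2 zero_less_one)

lemma DERIV_tilt: "(tilt has_real_derivative tilt' p) (at p)"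
  unfolding tilt_def[abs_def] tilt'_def
  by (rule derivative_eq_intros refl one_plus_square_nz)+
     (use one_plus_square_nz[of p] in \<open>simp add: field_simps power2_eq_square\<close>)

lemma DERIV_tilt': "(tilt' has_real_derivative tilt'' p) (at p)"
proof -
  have "((\<lambda>p. (1 - p\<^sup>2) * inverse (1 + p\<^sup>2) ^ 2) has_real_derivative
     (- 2 * p) * inverse (1 + p\<^sup>2) ^ 2 +
     (1 - p\<^sup>2) * (2 * inverse (1 + p\<^sup>2) * (- (inverse (1 + p\<^sup>2) * (2 * p) * inverse (1 + p\<^sup>2))))) (at p)"
    by (rule derivative_eq_intros refl one_plus_square_nz | simp)+
  moreover have "(- 2 * p) * inverse (1 + p\<^sup>2) ^ 2 +
     (1 - p\<^sup>2) * (2 * inverse (1 + p\<^sup>2) * (- (inverse (1 + p\<^sup>2) * (2 * p) * inverse (1 + p\<^sup>2)))) = tilt'' p"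
  proof -
    \<comment> \<open>Multiplying the first summand by \<open>u * (1 + p\<^sup>2)\<close>, which is
      \<open>1\<close>, makes all terms cubic in \<open>u\<close>; what is left is a polynomial
      identity.\<close>
    have "(- 2 * p) * u ^ 2 + (1 - p\<^sup>2) * (2 * u * (- (u * (2 * p) * u))) = (2 * p ^ 3 - 6 * p) * u ^ 3"
      if "u * (1 + p\<^sup>2) = 1" for u :: real
    proof -
      have "(- 2 * p) * u ^ 2 * (u * (1 + p\<^sup>2)) + (1 - p\<^sup>2) * (2 * u * (- (u * (2 * p) * u)))
          = (2 * p ^ 3 - 6 * p) * u ^ 3"
        by algebra
      thus ?thesis using that by simp
    qed
    from this[of "inverse (1 + p\<^sup>2)"] show ?thesis
      using one_plus_square_nz[of p] by (simp add: tilt''_def divide_inverse power_inverse)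
  qed
  moreover have "tilt' = (\<lambda>p. (1 - p\<^sup>2) * inverse (1 + p\<^sup>2) ^ 2)"
    by (simp add: fun_eq_iff tilt'_def divide_inverse power_inverse)
  ultimately show ?thesis by simp
qed

lemma continuous_on_tilt: "continuous_on S tilt" and continuous_on_tilt': "continuous_on S tilt'"
  and continuous_on_tilt'': "continuous_on S tilt''"
  unfolding tilt_def[abs_def] tilt'_def[abs_def] tilt''_def[abs_def]
  by (intro continuous_intros; simp add: one_plus_square_nz)+

text \<open>These bounds are uniform in the slope and thus keep \<open>w1\<close> out of the
  estimates of \<open>V\<close> and \<open>Vx\<close>.\<close>

lemma tilt_bound: "\<bar>tilt p\<bar> \<le> 1" and tilt'_bound: "\<bar>tilt' p\<bar> \<le> 1"
proof -
  have "2 * \<bar>p\<bar> \<le> 1 + p\<^sup>2"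
    using zero_le_power2[of "\<bar>p\<bar> - 1"] by (simp add: power2_diff)
  moreover have pos: "0 < 1 + p\<^sup>2" by (simp add: add_pos_nonneg)
  ultimately show "\<bar>tilt p\<bar> \<le> 1" by (simp add: tilt_def abs_divide)
  have "\<bar>1 - p\<^sup>2\<bar> \<le> (1 + p\<^sup>2) * 1" by (simp add: abs_le_iff)
  also have "\<dots> \<le> (1 + p\<^sup>2) * (1 + p\<^sup>2)" by (intro mult_left_mono) auto
  finally show "\<bar>tilt' p\<bar> \<le> 1" using pos by (simp add: tilt'_def abs_divide power2_eq_square)
qed

lemma tilt_eq: "tilt p * (1 + p\<^sup>2) = p"
  using one_plus_square_nz[of p] by (simp add: tilt_def)

lemma has_derivative_product_separate:
  fixes g h :: "real \<Rightarrow> real"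
  assumes "(g has_real_derivative g') (at (fst z))" "(h has_real_derivative h') (at (snd z))"
  shows "((\<lambda>z. h (snd z) * g (fst z)) has_derivative
    (\<lambda>v. h (snd z) * (g' * fst v) + h' * snd v * g (fst z))) (at z)"
proof (rule has_derivative_mult)
  show "((\<lambda>z. h (snd z)) has_derivative (\<lambda>v. h' * snd v)) (at z)"
    using has_derivative_compose[OF has_derivative_snd[OF has_derivative_ident]
        assms(2)[unfolded has_field_derivative_def]] by simp
  show "((\<lambda>z. g (fst z)) has_derivative (\<lambda>v. g' * fst v)) (at z)"
    using has_derivative_compose[OF has_derivative_fst[OF has_derivative_ident]
        assms(1)[unfolded has_field_derivative_def]] by simp
qed

text \<open>\<open>f\<close> stands for the extended perturbation and \<open>f1\<close>,
  \<open>f2\<close>, \<open>f3\<close> for its derivatives. The number \<open>100\<close> leaves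
  room for \<open>14 * (K * \<epsilon>) + 19 * (K\<^sup>2 * \<epsilon>) \<le> 1/2\<close>, the total
  in \<open>E_derivative_bound\<close>.\<close>

locale normal_graph_flow =
  fixes w w1 w2 w3 f f1 f2 f3 \<eta> \<eta>' :: "real \<Rightarrow> real" and a b c d K \<epsilon> :: real
  assumes w: "\<And>x. (w has_real_derivative w1 x) (at x)" "\<And>x. (w1 has_real_derivative w2 x) (at x)"
      "\<And>x. (w2 has_real_derivative w3 x) (at x)" "continuous_on UNIV w3"
    and f: "\<And>x. (f has_real_derivative f1 x) (at x)" "\<And>x. (f1 has_real_derivative f2 x) (at x)"
      "\<And>x. (f2 has_real_derivative f3 x) (at x)" "continuous_on UNIV f3"
    and ab: "-1 < a" "a < b" "b < 1"
    and f_supp: "\<And>x. x \<notin> {a<..<b} \<Longrightarrow> f x = 0" "\<And>x. x \<notin> {a<..<b} \<Longrightarrow> f1 x = 0"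
    and f_small: "\<And>x. \<bar>f x\<bar> \<le> \<epsilon>" "\<And>x. \<bar>f1 x\<bar> \<le> \<epsilon>" "\<And>x. \<bar>f2 x\<bar> \<le> \<epsilon>"
    and K: "1 \<le> K" "\<And>x. x \<in> {-1..1} \<Longrightarrow> \<bar>w1 x\<bar> \<le> K" "\<And>x. x \<in> {-1..1} \<Longrightarrow> \<bar>w2 x\<bar> \<le> K"
      "\<And>y. \<bar>\<eta>' y\<bar> \<le> K"
    and \<epsilon>: "100 * K\<^sup>2 * \<epsilon> \<le> 1"
    and \<eta>: "C2_open UNIV \<eta>" "\<And>y. (\<eta> has_real_derivative \<eta>' y) (at y)" "\<And>y. \<bar>\<eta> y\<bar> \<le> 1"
    and cd: "0 < c" "\<And>y. y \<notin> {c..d} \<Longrightarrow> \<eta> y = 0"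
    and \<eta>_w: "\<And>x. x \<in> {-1..1} \<Longrightarrow> \<eta> (w x) = 1"
begin

definition slope :: "real \<Rightarrow> real \<Rightarrow> real" where
  "slope s x = w1 x + s * f1 x"

definition curv :: "real \<Rightarrow> real \<Rightarrow> real" where
  "curv s x = w2 x + s * f2 x"

definition V :: "real \<Rightarrow> real \<Rightarrow> real" where
  "V s x = - (f x * tilt (slope s x))"

definition Vs :: "real \<Rightarrow> real \<Rightarrow> real" where
  "Vs s x = - (f x * (tilt' (slope s x) * f1 x))"

definition Vx :: "real \<Rightarrow> real \<Rightarrow> real" where
  "Vx s x = - (f1 x * tilt (slope s x) + f x * (tilt' (slope s x) * curv s x))"

definition Vxx :: "real \<Rightarrow> real \<Rightarrow> real" where
  "Vxx s x = - (f2 x * tilt (slope s x) + 2 * f1 x * (tilt' (slope s x) * curv s x)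
     + f x * (tilt'' (slope s x) * curv s x * curv s x + tilt' (slope s x) * (w3 x + s * f3 x)))"

lemma \<epsilon>_nonneg: "0 \<le> \<epsilon>"
  using f_small(1)[of 0] by simp

lemma \<epsilon>_bounds: "\<epsilon> \<le> K * \<epsilon>" "K * \<epsilon> \<le> K\<^sup>2 * \<epsilon>" "100 * (K * \<epsilon>) \<le> 1" "100 * \<epsilon> \<le> 1"
proof -
  show 1: "\<epsilon> \<le> K * \<epsilon>" using mult_right_mono[OF K(1) \<epsilon>_nonneg] by simp
  show 2: "K * \<epsilon> \<le> K\<^sup>2 * \<epsilon>"
    using mult_right_mono[OF K(1), of "K * \<epsilon>"] K(1) \<epsilon>_nonneg by (simp add: power2_eq_square mult.assoc)
  show "100 * (K * \<epsilon>) \<le> 1" "100 * \<epsilon> \<le> 1" using 1 2 \<epsilon> by linarith+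
qed

lemma continuous_on_coeffs:
  "continuous_on S w" "continuous_on S w1" "continuous_on S w2" "continuous_on S w3"
  "continuous_on S f" "continuous_on S f1" "continuous_on S f2" "continuous_on S f3"
  using w f by (meson DERIV_continuous_on has_field_derivative_at_within continuous_on_subset subset_UNIV)+

lemma DERIV_slope_time: "((\<lambda>s. slope s x) has_real_derivative f1 x) (at s)"
  unfolding slope_def by (auto intro!: derivative_eq_intros)

lemma DERIV_slope: "(slope s has_real_derivative curv s x) (at x)"
  unfolding slope_def[abs_def] curv_def by (auto intro!: derivative_eq_intros w f)

lemma DERIV_curv: "(curv s has_real_derivative w3 x + s * f3 x) (at x)"
  unfolding curv_def[abs_def] by (auto intro!: derivative_eq_intros w f)

lemma continuous_on_snd_compose: "continuous_on UNIV h \<Longrightarrow> continuous_on S (\<lambda>z. h (snd z))" for h :: "real \<Rightarrow> real"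
  by (rule continuous_on_compose2) (auto intro: continuous_intros)

lemma continuous_on_slope: "continuous_on S (\<lambda>z. slope (fst z) (snd z))"
  and continuous_on_curv: "continuous_on S (\<lambda>z. curv (fst z) (snd z))"
  unfolding slope_def curv_def
  by (intro continuous_intros continuous_on_snd_compose continuous_on_coeffs)+

lemma continuous_on_slope_compose:
  "continuous_on UNIV h \<Longrightarrow> continuous_on S (\<lambda>z. h (slope (fst z) (snd z)))" for h :: "real \<Rightarrow> real"
  by (rule continuous_on_compose2[OF _ continuous_on_slope]) auto

text \<open>In \<open>3 * (K * \<epsilon>)\<close> one part comes from \<open>f1 * tilt\<close> and
  two from \<open>f * tilt' * curv\<close>, where \<open>\<bar>curv\<bar> \<le> 2 * K\<close> on
  \<open>(a, b)\<close>.\<close>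

sublocale scalar_ode V Vs Vx Vxx \<epsilon> "3 * (K * \<epsilon>)"
proof
  fix s x
  show "((\<lambda>s. V s x) has_real_derivative Vs s x) (at s)"
    unfolding V_def Vs_def
    by (intro Deriv.field_differentiable_minus DERIV_cmult DERIV_chain2[OF DERIV_tilt] DERIV_slope_time)
  show "(V s has_real_derivative Vx s x) (at x)"
    unfolding V_def[abs_def] Vx_def
    by (rule derivative_eq_intros f DERIV_chain2[OF DERIV_tilt] DERIV_slope refl)+ simp
  show "(Vx s has_real_derivative Vxx s x) (at x)"
    unfolding Vx_def[abs_def] Vxx_def
    by (rule derivative_eq_intros f DERIV_chain2[OF DERIV_tilt] DERIV_chain2[OF DERIV_tilt']
          DERIV_slope DERIV_curv refl)+ (simp add: algebra_simps)
  have fN: "\<bar>f x * tilt (slope s x)\<bar> \<le> \<epsilon> * 1"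
    unfolding abs_mult by (intro mult_mono f_small tilt_bound) (use \<epsilon>_nonneg in auto)
  thus "\<bar>V s x\<bar> \<le> \<epsilon>" by (simp add: V_def)
  show "\<bar>Vx s x\<bar> \<le> 3 * (K * \<epsilon>)" if s: "s \<in> {-1..2}"
  \<comment> \<open>\<open>K\<close> bounds \<open>w2\<close> only on \<open>[-1, 1]\<close>; off
    \<open>(a, b)\<close> both \<open>f\<close> and \<open>f1\<close> vanish, and \<open>Vx\<close>
    with them.\<close>
  proof (cases "x \<in> {a<..<b}")
    case True
    have "\<bar>curv s x\<bar> \<le> \<bar>w2 x\<bar> + \<bar>s\<bar> * \<bar>f2 x\<bar>"
      unfolding curv_def abs_mult[symmetric] by (rule abs_triangle_ineq)
    also have "\<dots> \<le> K + 2 * \<epsilon>"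
      using True ab s by (intro add_mono mult_mono K f_small) auto
    also have "\<dots> \<le> 2 * K" using \<epsilon>_bounds K(1) by linarith
    finally have "\<bar>tilt' (slope s x) * curv s x\<bar> \<le> 1 * (2 * K)"
      unfolding abs_mult by (intro mult_mono tilt'_bound) auto
    hence "\<bar>f x * (tilt' (slope s x) * curv s x)\<bar> \<le> \<epsilon> * (2 * K)"
      unfolding abs_mult[of "f x"] by (intro mult_mono f_small) (use \<epsilon>_nonneg in auto)
    moreover have "\<bar>f1 x * tilt (slope s x)\<bar> \<le> \<epsilon> * 1"
      unfolding abs_mult by (intro mult_mono f_small tilt_bound) (use \<epsilon>_nonneg in auto)
    moreover have "\<epsilon> * (2 * K) = 2 * (K * \<epsilon>)" by simp
    ultimately have "\<bar>f1 x * tilt (slope s x)\<bar> + \<bar>f x * (tilt' (slope s x) * curv s x)\<bar> \<le> 3 * (K * \<epsilon>)"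
      using \<epsilon>_bounds(1) by linarith
    thus ?thesis unfolding Vx_def abs_minus_cancel by (rule order_trans[OF abs_triangle_ineq])
  next
    case False
    thus ?thesis using K(1) \<epsilon>_nonneg by (simp add: Vx_def f_supp)
  qed
  show "3 * (K * \<epsilon>) \<le> 1/4" using \<epsilon>_bounds by linarith
qed (unfold V_def Vs_def Vx_def Vxx_def split_beta,
     (intro continuous_intros continuous_on_snd_compose continuous_on_slope_compose
        continuous_on_coeffs continuous_on_tilt continuous_on_tilt' continuous_on_tilt'' continuous_on_curv)+)

lemma \<xi>_outside:
  assumes "x \<notin> {a<..<b}"
  shows "\<xi> s x = x"
  using \<xi>_stationary[OF _ clamp_in, of x s] assms by (simp add: V_def f_supp \<xi>_clamp)

lemma J_outside:
  assumes "x \<notin> {a<..<b}"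
  shows "J s x = 1"
  using assms by (simp add: J_def \<xi>_outside Vx_def f_supp signed_integral_def)

lemma \<xi>_mono:
  assumes "s \<in> {-1..2}" "x \<le> y"
  shows "\<xi> s x \<le> \<xi> s y"
proof -
  have "0 \<le> \<xi> s y - \<xi> s x"
    unfolding \<xi>_diff[OF assms(1)] using assms(2) by (intro mult_nonneg_nonneg) auto
  thus ?thesis by simp
qed

text \<open>The points \<open>-1\<close> and \<open>1\<close> are stationary and
  \<open>\<xi> s\<close> is monotone. Remaining in \<open>[-1, 1]\<close> matters because the bounds
  on \<open>w1\<close> and \<open>w2\<close> hold there.\<close>

lemma \<xi>_in:
  assumes "s \<in> {-1..2}" "x \<in> {-1..1}"
  shows "\<xi> s x \<in> {-1..1}"
  using \<xi>_mono[OF assms(1), of "-1" x] \<xi>_mono[OF assms(1), of x 1] assms(2) ab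
  by (auto simp: \<xi>_outside)

section \<open>Displacement of the graph and its extension to the strip\<close>

definition shift :: "real \<Rightarrow> real \<Rightarrow> real" where
  "shift s x = w (\<xi> s x) + s * f (\<xi> s x) - w x"

definition shift' :: "real \<Rightarrow> real \<Rightarrow> real" where
  "shift' s x = slope s (\<xi> s x) * J s x - w1 x"

lemma DERIV_shift:
  assumes "s \<in> {-1..2}"
  shows "(shift s has_real_derivative shift' s x) (at x)"
  unfolding shift_def[abs_def] shift'_def slope_def
  by (rule derivative_eq_intros DERIV_chain2[OF w(1)] DERIV_chain2[OF f(1)] w \<xi>_space_derivative assms refl)+
     (simp add: algebra_simps)

lemma J_near_1: "s \<in> {-1..2} \<Longrightarrow> \<bar>J s x - 1\<bar> \<le> 12 * (K * \<epsilon>)"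
  using J_bound[of s x] by simp

lemma mean_value_bound_K:
  assumes "u \<in> {-1..1::real}" "v \<in> {-1..1}" "\<And>x. (g has_real_derivative g' x) (at x)"
    "\<And>x. x \<in> {-1..1} \<Longrightarrow> \<bar>g' x\<bar> \<le> K"
  shows "\<bar>g u - g v\<bar> \<le> K * \<bar>u - v\<bar>"
proof -
  have "norm (g u - g v) \<le> K * norm (u - v)"
    by (rule field_differentiable_bound[where S="{-1..1}" and f'=g'])
       (use assms in \<open>auto intro: has_field_derivative_at_within\<close>)
  thus ?thesis by simp
qed

text \<open>Horizontal displacement at most \<open>2 * \<epsilon>\<close> moves \<open>w\<close> by
  at most \<open>2 * (K * \<epsilon>)\<close>, and \<open>s * f\<close> adds
  \<open>\<epsilon>\<close>. Off \<open>(a, b)\<close> both quantities vanish.\<close>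

lemma shift_bounds:
  assumes s: "s \<in> {0..1}"
  shows "\<bar>shift s x\<bar> \<le> 3 * (K * \<epsilon>)" "\<bar>shift' s x\<bar> \<le> 16 * (K\<^sup>2 * \<epsilon>)"
proof -
  have s': "s \<in> {-1..2}" using s by auto
  have "\<bar>shift s x\<bar> \<le> 3 * (K * \<epsilon>) \<and> \<bar>shift' s x\<bar> \<le> 16 * (K\<^sup>2 * \<epsilon>)"
  proof (cases "x \<in> {a<..<b}")
    case False
    thus ?thesis
      using \<epsilon>_nonneg K(1) by (simp add: shift_def shift'_def slope_def \<xi>_outside J_outside f_supp)
  next
    case True
    hence x: "x \<in> {-1..1}" using ab by auto
    note \<xi>x = \<xi>_in[OF s' x]
    have disp: "K * \<bar>\<xi> s x - x\<bar> \<le> K * (2 * \<epsilon>)"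
      using K(1) by (intro mult_left_mono \<xi>_displacement[OF s']) auto
    have sf: "\<bar>s * g\<bar> \<le> \<epsilon>" if "\<bar>g\<bar> \<le> \<epsilon>" for g
      using mult_mono[of "\<bar>s\<bar>" 1 "\<bar>g\<bar>" \<epsilon>] s that by (simp add: abs_mult)
    have "\<bar>w (\<xi> s x) - w x\<bar> \<le> K * \<bar>\<xi> s x - x\<bar>"
      by (rule mean_value_bound_K[OF \<xi>x x w(1) K(2)])
    with disp sf[OF f_small(1)[of "\<xi> s x"]] have 1: "\<bar>shift s x\<bar> \<le> 3 * (K * \<epsilon>)"
      using \<epsilon>_bounds(1) unfolding shift_def by linarith
    have J: "\<bar>J s x - 1\<bar> \<le> 12 * (K * \<epsilon>)" by (rule J_near_1[OF s'])
    have J2: "\<bar>J s x\<bar> \<le> 2" using J \<epsilon>_bounds(3) by linarith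
    \<comment> \<open>The three summands contribute \<open>12\<close>, \<open>2\<close> and
      \<open>2\<close> multiples of \<open>K\<^sup>2 * \<epsilon>\<close>.\<close>
    have "shift' s x = w1 (\<xi> s x) * (J s x - 1) + (w1 (\<xi> s x) - w1 x) + s * f1 (\<xi> s x) * J s x"
      by (simp add: shift'_def slope_def algebra_simps)
    moreover have "\<bar>w1 (\<xi> s x) * (J s x - 1)\<bar> \<le> K * (12 * (K * \<epsilon>))"
      unfolding abs_mult using K(1) by (intro mult_mono K(2)[OF \<xi>x] J) auto
    moreover have "\<bar>w1 (\<xi> s x) - w1 x\<bar> \<le> K * \<bar>\<xi> s x - x\<bar>"
      by (rule mean_value_bound_K[OF \<xi>x x w(2) K(3)])
    moreover have "\<bar>s * f1 (\<xi> s x) * J s x\<bar> \<le> \<epsilon> * 2"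
      unfolding abs_mult[of _ "J s x"] using \<epsilon>_nonneg by (intro mult_mono sf f_small J2) auto
    moreover have "K * (12 * (K * \<epsilon>)) = 12 * (K\<^sup>2 * \<epsilon>)" by (simp add: power2_eq_square)
    ultimately have "\<bar>shift' s x\<bar> \<le> 16 * (K\<^sup>2 * \<epsilon>)"
      using disp \<epsilon>_bounds(1,2) by linarith
    with 1 show ?thesis by simp
  qed
  thus "\<bar>shift s x\<bar> \<le> 3 * (K * \<epsilon>)" "\<bar>shift' s x\<bar> \<le> 16 * (K\<^sup>2 * \<epsilon>)" by auto
qed

text \<open>Both components are products of a function of \<open>y\<close> and a function of
  \<open>x\<close>, so the differential is estimated from one-variable bounds.\<close>

definition E :: "real \<Rightarrow> pt \<Rightarrow> pt" where
  "E s z = (\<eta> (snd z) * (\<xi> s (fst z) - fst z), \<eta> (snd z) * shift s (fst z))"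

definition \<Phi> :: "real \<Rightarrow> pt \<Rightarrow> pt" where
  "\<Phi> s z = z + E s z"

lemma C2_open_w: "C2_open UNIV w" and C2_open_f: "C2_open UNIV f"
  by (rule C2_open_real, rule w f, rule C1_open_real, rule w f, rule continuous_on_coeffs)+

lemma C2_open_E: "C2_open ({-1<..<2} \<times> UNIV) (\<lambda>z. E (fst z) (snd z))"
proof -
  let ?T = "{-1<..<2::real} \<times> (UNIV :: pt set)"
  have lin: "bounded_linear (\<lambda>z::real \<times> pt. fst (snd z))" "bounded_linear (\<lambda>z::real \<times> pt. snd (snd z))"
    using bounded_linear_compose[OF bounded_linear_fst bounded_linear_snd]
      bounded_linear_compose[OF bounded_linear_snd bounded_linear_snd] by simp_all
  note s = C2_open_linear[OF bounded_linear_fst, where V="?T"]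
    and x = C2_open_linear[OF lin(1), where V="?T"] and y = C2_open_linear[OF lin(2), where V="?T"]
  have \<xi>: "C2_open ?T (\<lambda>z. \<xi> (fst z) (fst (snd z)))"
    using C2_open_compose[OF C2_open_\<xi> C2_open_Pair[OF s x]] by auto
  have \<eta>: "C2_open ?T (\<lambda>z. \<eta> (snd (snd z)))"
    by (rule C2_open_compose[OF \<eta>(1) y]) simp
  have w: "C2_open ?T (\<lambda>z. w (fst (snd z)))" "C2_open ?T (\<lambda>z. w (\<xi> (fst z) (fst (snd z))))"
    by (rule C2_open_compose[OF C2_open_w x] C2_open_compose[OF C2_open_w \<xi>], simp)+
  have f: "C2_open ?T (\<lambda>z. f (\<xi> (fst z) (fst (snd z))))"
    by (rule C2_open_compose[OF C2_open_f \<xi>]) simp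
  show ?thesis
    unfolding E_def shift_def
    by (intro C2_open_Pair C2_open_bilinear[OF bounded_bilinear_mult] C2_open_diff C2_open_add s x w f \<xi> \<eta>)
qed

lemma C2_open_\<Phi>: "C2_open ({-1<..<2} \<times> UNIV) (\<lambda>(s, z). \<Phi> s z)"
  unfolding split_beta \<Phi>_def by (intro C2_open_add C2_open_E C2_open_linear bounded_linear_snd)

lemma C1_open_E:
  assumes "s \<in> {0..1}"
  shows "C1_open UNIV (E s)"
  using C1_open_compose[OF C2_open_imp_C1_open[OF C2_open_E] C1_open_Pair[OF C1_open_const C1_open_linear[OF bounded_linear_ident]],
      of UNIV s] assms by auto

lemma E_derivative_bound:
  assumes s: "s \<in> {0..1}" and E': "(E s has_derivative E') (at z)"
  shows "norm (E' v) \<le> norm v / 2"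
proof -
  have s': "s \<in> {-1..2}" using s by auto
  let ?x = "fst z" and ?y = "snd z"
  have "(E s has_derivative (\<lambda>v. (\<eta> ?y * ((J s ?x - 1) * fst v) + \<eta>' ?y * snd v * (\<xi> s ?x - ?x),
      \<eta> ?y * (shift' s ?x * fst v) + \<eta>' ?y * snd v * shift s ?x))) (at z)"
    unfolding E_def[abs_def]
  proof (intro has_derivative_Pair has_derivative_product_separate \<eta> DERIV_shift[OF s'])
    show "((\<lambda>x. \<xi> s x - x) has_real_derivative J s ?x - 1) (at ?x)"
      by (intro Deriv.field_differentiable_diff \<xi>_space_derivative[OF s'] DERIV_ident)
  qed
  from has_derivative_unique[OF E' this]
  have E': "E' v = (\<eta> ?y * ((J s ?x - 1) * fst v) + \<eta>' ?y * snd v * (\<xi> s ?x - ?x),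
      \<eta> ?y * (shift' s ?x * fst v) + \<eta>' ?y * snd v * shift s ?x)" by simp
  have fs: "\<bar>fst v\<bar> \<le> norm v" "\<bar>snd v\<bar> \<le> norm v"
    using norm_fst_le[of "fst v" "snd v"] norm_snd_le[of "snd v" "fst v"] by auto
  have component: "\<bar>\<eta> ?y * (p * fst v) + \<eta>' ?y * snd v * q\<bar> \<le> (P + K * Q) * norm v"
    if "\<bar>p\<bar> \<le> P" "\<bar>q\<bar> \<le> Q" for p q P Q
  proof -
    have "\<bar>\<eta> ?y * (p * fst v)\<bar> \<le> 1 * (P * norm v)"
      unfolding abs_mult using that by (intro mult_mono \<eta> fs) auto
    moreover have "\<bar>\<eta>' ?y * snd v * q\<bar> \<le> K * norm v * Q"
      unfolding abs_mult using that K(1) by (intro mult_mono K(4) fs) auto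
    ultimately show ?thesis
      using abs_triangle_ineq[of "\<eta> ?y * (p * fst v)" "\<eta>' ?y * snd v * q"]
      by (simp add: algebra_simps)
  qed
  have "norm (E' v) \<le> \<bar>fst (E' v)\<bar> + \<bar>snd (E' v)\<bar>"
    using norm_Pair_le[of "fst (E' v)" "snd (E' v)"] by simp
  \<comment> \<open>In each component the first term comes from differentiating the displacement,
    the second from \<open>\<eta>'\<close> times the displacement itself.\<close>
  also have "\<dots> \<le> (12 * (K * \<epsilon>) + K * (2 * \<epsilon>)) * norm v + (16 * (K\<^sup>2 * \<epsilon>) + K * (3 * (K * \<epsilon>))) * norm v"
    unfolding E' fst_conv snd_conv
    by (intro add_mono component J_near_1[OF s'] \<xi>_displacement[OF s'] shift_bounds[OF s])
  also have "\<dots> = (14 * (K * \<epsilon>) + 19 * (K\<^sup>2 * \<epsilon>)) * norm v"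
    by (simp add: algebra_simps power2_eq_square)
  also have "\<dots> \<le> (1/2) * norm v"
    using \<epsilon>_bounds \<epsilon> by (intro mult_right_mono) auto
  finally show ?thesis by simp
qed

lemma
  assumes s: "s \<in> {0..1}"
  shows bij_\<Phi>: "bij (\<Phi> s)" and C1_open_inv_\<Phi>: "C1_open UNIV (inv (\<Phi> s))"
proof -
  have \<Phi>: "\<Phi> s = (\<lambda>x. x + E s x)" by (simp add: \<Phi>_def[abs_def])
  show "bij (\<Phi> s)" "C1_open UNIV (inv (\<Phi> s))"
    unfolding \<Phi>
    by (rule small_perturbation_of_identity[OF C1_open_E[OF s]], erule E_derivative_bound[OF s])+
qed

lemma C1_open_\<Phi>: "s \<in> {0..1} \<Longrightarrow> C1_open UNIV (\<Phi> s)"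
  unfolding \<Phi>_def[abs_def] by (intro C1_open_add C1_open_E C1_open_linear bounded_linear_ident)

lemma \<Phi>_support: "\<Phi> s z \<noteq> z \<Longrightarrow> z \<in> {a..b} \<times> {c..d}"
proof (rule ccontr)
  assume "\<Phi> s z \<noteq> z" "z \<notin> {a..b} \<times> {c..d}"
  moreover from this(2) have "fst z \<notin> {a<..<b} \<or> snd z \<notin> {c..d}" by (cases z) auto
  hence "E s z = 0"
    using \<xi>_outside[of "fst z" s] f_supp[of "fst z"] cd(2)[of "snd z"]
    by (auto simp: E_def shift_def zero_prod_def)
  ultimately show False by (simp add: \<Phi>_def)
qed

section \<open>Admissibility of the flow\<close>

lemma Omega_subset: "Omega \<subseteq> Omega_bar"
  by (simp add: Omega_bar_def closure_subset)

lemma support_subset: "{a..b} \<times> {c..d} \<subseteq> Omega"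
  using ab cd(1) by (auto simp: Omega_def)

lemma bij_betw_\<Phi>: "s \<in> {0..1} \<Longrightarrow> bij_betw (\<Phi> s) Omega_bar Omega_bar"
proof (rule bij_betw_of_id_outside[OF bij_\<Phi>])
  show "\<Phi> s z = z" if "z \<notin> Omega_bar" for z
    using \<Phi>_support[of s z] support_subset Omega_subset that by blast
qed

lemma inv_into_\<Phi>:
  assumes "s \<in> {0..1}" "z \<in> Omega_bar"
  shows "inv_into Omega_bar (\<Phi> s) (\<Phi> s z) = z"
  using bij_betw_\<Phi>[OF assms(1)] assms(2) by (simp add: bij_betw_def inv_into_f_f)

lemma diffeo_\<Phi>:
  assumes s: "s \<in> {0..1}"
  shows "diffeo_onto Omega_bar (\<Phi> s)"
  unfolding diffeo_onto_def
proof (intro conjI)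
  show "bij_betw (\<Phi> s) Omega_bar Omega_bar" by (rule bij_betw_\<Phi>[OF s])
  show "C1_on Omega_bar (\<Phi> s)"
    unfolding C1_on_def using C1_open_\<Phi>[OF s] by (intro exI[of _ UNIV] exI[of _ "\<Phi> s"]) auto
  \<comment> \<open>The inverse on the plane is the C1 extension that \<open>C1_on\<close> asks
    for.\<close>
  have "inv (\<Phi> s) y = inv_into Omega_bar (\<Phi> s) y" if "y \<in> Omega_bar" for y
  proof -
    obtain z where z: "z \<in> Omega_bar" "y = \<Phi> s z"
      using bij_betw_\<Phi>[OF s] \<open>y \<in> Omega_bar\<close> by (metis bij_betw_imp_surj_on imageE)
    show ?thesis
      unfolding z(2) inv_into_\<Phi>[OF s z(1)] by (rule inv_f_f[OF bij_is_inj[OF bij_\<Phi>[OF s]]])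
  qed
  thus "C1_on Omega_bar (inv_into Omega_bar (\<Phi> s))"
    unfolding C1_on_def using C1_open_inv_\<Phi>[OF s] by (intro exI[of _ UNIV] exI[of _ "inv (\<Phi> s)"]) auto
qed

lemma admissible_flow_\<Phi>: "admissible_flow \<Phi>"
  unfolding admissible_flow_def
proof (intro conjI ballI)
  show "C2_on ({0..1} \<times> Omega_bar) (\<lambda>(s, x). \<Phi> s x)"
    unfolding C2_on_def using C2_open_\<Phi>
    by (intro exI[of _ "{-1<..<2} \<times> UNIV"] exI[of _ "\<lambda>(s, x). \<Phi> s x"]) (auto intro: open_Times)
  show "diffeo_onto Omega_bar (\<Phi> s)" if "s \<in> {0..1}" for s
    by (rule diffeo_\<Phi>[OF that])
  show "\<Phi> 0 x = x" for x
    by (simp add: \<Phi>_def E_def shift_def zero_prod_def[symmetric])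
  \<comment> \<open>Three sides lie halfway between the rectangle
    \<open>[a, b] \<times> [c, d]\<close> and the boundary of \<open>Omega\<close>, the fourth one
    unit above it.\<close>
  let ?l = "((a - 1) / 2, c / 2)" and ?u = "((b + 1) / 2, d + 1)"
  have box: "box ?l ?u = {(a - 1) / 2<..<(b + 1) / 2} \<times> {c / 2<..<d + 1}"
    by (auto simp: box_def Basis_prod_def inner_Pair)
  have cbox: "cbox ?l ?u = {(a - 1) / 2..(b + 1) / 2} \<times> {c / 2..d + 1}"
    by (simp add: cbox_Pair_eq)
  have cl: "closure (box ?l ?u) \<subseteq> cbox ?l ?u"
    unfolding box cbox by (intro closure_minimal closed_Times closed_atLeastAtMost) auto
  show "\<exists>U. open U \<and> compact (closure U) \<and> closure U \<subseteq> Omega \<and>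
      (\<forall>s\<in>{0..1}. closure {x \<in> Omega_bar. \<Phi> s x \<noteq> x} \<subseteq> U)"
  proof (intro exI[of _ "box ?l ?u"] conjI ballI)
    show "compact (closure (box ?l ?u))"
      by (simp add: compact_closure bounded_box)
    show "closure (box ?l ?u) \<subseteq> Omega"
      using cl ab cd(1) unfolding cbox by (force simp: Omega_def)
    fix s :: real
    have "closure {x \<in> Omega_bar. \<Phi> s x \<noteq> x} \<subseteq> {a..b} \<times> {c..d}"
      using \<Phi>_support by (intro closure_minimal closed_Times) auto
    also have "\<dots> \<subseteq> box ?l ?u"
      unfolding box using ab cd(1) by auto
    finally show "closure {x \<in> Omega_bar. \<Phi> s x \<noteq> x} \<subseteq> box ?l ?u" .
  qed (rule open_box)
qed

section \<open>The image of the graph and orthogonality\<close>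

lemma \<Phi>_on_graph:
  assumes "x \<in> {-1..1}"
  shows "\<Phi> s (x, w x) = (\<xi> s x, w (\<xi> s x) + s * f (\<xi> s x))"
  using assms by (simp add: \<Phi>_def E_def shift_def \<eta>_w)

text \<open>The perturbation lemma in dimension one, with
  \<open>\<bar>J - 1\<bar> \<le> 12 * (K * \<epsilon>) \<le> 1/2\<close>. It ensures that the moved
  points cover the entire perturbed graph.\<close>

lemma bij_betw_\<xi>:
  assumes s: "s \<in> {0..1}"
  shows "bij_betw (\<xi> s) {-1<..<1} {-1<..<1}"
proof (rule bij_betw_of_id_outside)
  have s': "s \<in> {-1..2}" using s by auto
  have der: "((\<lambda>x. \<xi> s x - x) has_real_derivative J s x - 1) (at x)" for x
    by (intro Deriv.field_differentiable_diff \<xi>_space_derivative[OF s'] DERIV_ident)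
  have "bij (\<lambda>x. x + (\<xi> s x - x))"
  proof (rule small_perturbation_of_identity)
    have "continuous_on UNIV (\<lambda>x. J s x - 1)"
      by (intro continuous_intros continuous_on_binary_compose[OF continuous_on_J])
    thus "C1_open UNIV (\<lambda>x. \<xi> s x - x)" by (rule C1_open_real[OF der])
    fix E' x h assume "((\<lambda>x. \<xi> s x - x) has_derivative E') (at x)"
    from has_derivative_unique[OF this der[unfolded has_field_derivative_def]]
    have "norm (E' h) = \<bar>J s x - 1\<bar> * \<bar>h\<bar>" by (simp add: abs_mult)
    also have "\<dots> \<le> 1/2 * \<bar>h\<bar>"
      using J_near_1[OF s', of x] \<epsilon>_bounds by (intro mult_right_mono) auto
    finally show "norm (E' h) \<le> norm h / 2" by simp
  qed
  thus "bij (\<xi> s)" by simp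
  show "\<xi> s x = x" if "x \<notin> {-1<..<1}" for x
    using that ab by (intro \<xi>_outside) auto
qed

lemma \<Phi>_image_graph:
  assumes s: "s \<in> {0..1}"
  shows "\<Phi> s ` Gamma w = {(x, w x + s * f x) | x. -1 < x \<and> x < 1}"
proof -
  have "\<Phi> s ` Gamma w = (\<lambda>x. (\<xi> s x, w (\<xi> s x) + s * f (\<xi> s x))) ` {-1<..<1}"
    unfolding Gamma_def image_def by (auto simp: \<Phi>_on_graph intro!: exI)
  also have "\<dots> = (\<lambda>x. (x, w x + s * f x)) ` \<xi> s ` {-1<..<1}"
    by (simp add: image_image)
  also have "\<xi> s ` {-1<..<1} = {-1<..<1}"
    using bij_betw_\<xi>[OF s] by (simp add: bij_betw_def)
  finally show ?thesis by auto
qed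

lemma velocity_orthogonal:
  assumes s: "s \<in> {0..1}" and x: "x \<in> {-1<..<1}" and wx: "w x > 0"
  shows "velocity \<Phi> s (\<Phi> s (x, w x)) \<bullet> tau_s w \<Phi> s (\<Phi> s (x, w x)) = 0"
proof -
  have s': "s \<in> {-1..2}" "s \<in> {-1<..<2}" and x': "x \<in> {-1..1}" using s x by auto
  have "(x, w x) \<in> Omega" using x wx by (simp add: Omega_def)
  hence inv: "inv_into Omega_bar (\<Phi> s) (\<Phi> s (x, w x)) = (x, w x)"
    using Omega_subset by (intro inv_into_\<Phi>[OF s]) auto
  let ?v = "V s (\<xi> s x)" and ?g = "slope s (\<xi> s x)"
  have "((\<lambda>r. (\<xi> r x, w (\<xi> r x) + r * f (\<xi> r x))) has_vector_derivative
      (?v, ?g * ?v + f (\<xi> s x))) (at s)"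
  proof (rule has_vector_derivative_Pair)
    show "((\<lambda>r. \<xi> r x) has_vector_derivative ?v) (at s)"
      using \<xi>_time_derivative[OF s'(2)] by (simp add: has_real_derivative_iff_has_vector_derivative)
    have "((\<lambda>r. w (\<xi> r x) + r * f (\<xi> r x)) has_real_derivative ?g * ?v + f (\<xi> s x)) (at s)"
      unfolding slope_def
      by (rule derivative_eq_intros DERIV_chain2[OF w(1)] DERIV_chain2[OF f(1)]
          \<xi>_time_derivative[OF s'(2)] refl)+ (simp add: algebra_simps)
    thus "((\<lambda>r. w (\<xi> r x) + r * f (\<xi> r x)) has_vector_derivative ?g * ?v + f (\<xi> s x)) (at s)"
      by (simp add: has_real_derivative_iff_has_vector_derivative)
  qed
  \<comment> \<open>At times \<open>0\<close> and \<open>1\<close> too this restricts a two-sided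
    derivative, since solutions exist on a longer interval.\<close>
  hence "((\<lambda>r. \<Phi> r (x, w x)) has_vector_derivative (?v, ?g * ?v + f (\<xi> s x))) (at s within {0..1})"
    by (simp add: \<Phi>_on_graph[OF x'] has_vector_derivative_at_within)
  hence vel: "velocity \<Phi> s (\<Phi> s (x, w x)) = (?v, ?g * ?v + f (\<xi> s x))"
    unfolding velocity_def flow_dot_def inv
    using s by (intro vector_derivative_within_cbox[of 0 1, simplified]) auto
  let ?D = "frechet_derivative (\<Phi> s) (at (x, w x))"
  have "\<Phi> s differentiable (at (x, w x))"
    using C1_open_\<Phi>[OF s] by (auto simp: C1_open_def differentiable_def)
  hence D: "(\<Phi> s has_derivative ?D) (at (x, w x))"
    by (simp add: frechet_derivative_works)
  \<comment> \<open>The image of the tangent is found by differentiating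
    \<open>x \<mapsto> \<Phi> s (x, w x)\<close> in two ways: by the chain rule and from the
    explicit formula on the graph.\<close>
  have "((\<lambda>x. (x, w x)) has_derivative (\<lambda>h. (h, w1 x * h))) (at x)"
    using w(1)[of x] by (intro has_derivative_Pair has_derivative_ident) (simp add: has_field_derivative_def)
  from has_derivative_compose[OF this D]
  have D1: "((\<lambda>x. \<Phi> s (x, w x)) has_derivative (\<lambda>h. ?D (h, w1 x * h))) (at x)" .
  have "((\<lambda>x. (\<xi> s x, w (\<xi> s x) + s * f (\<xi> s x))) has_derivative
      (\<lambda>h. (J s x * h, ?g * J s x * h))) (at x)"
  proof (rule has_derivative_Pair)
    show "(\<xi> s has_derivative (\<lambda>h. J s x * h)) (at x)"
      using \<xi>_space_derivative[OF s'(1)] by (simp add: has_field_derivative_def)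
    have "((\<lambda>x. w (\<xi> s x) + s * f (\<xi> s x)) has_real_derivative ?g * J s x) (at x)"
      unfolding slope_def
      by (rule derivative_eq_intros DERIV_chain2[OF w(1)] DERIV_chain2[OF f(1)]
          \<xi>_space_derivative[OF s'(1)] refl)+ (simp add: algebra_simps)
    thus "((\<lambda>x. w (\<xi> s x) + s * f (\<xi> s x)) has_derivative (\<lambda>h. ?g * J s x * h)) (at x)"
      by (simp add: has_field_derivative_def)
  qed
  hence "((\<lambda>x. \<Phi> s (x, w x)) has_derivative (\<lambda>h. (J s x * h, ?g * J s x * h))) (at x)"
    by (rule has_derivative_transform_within_open[where s="{-1<..<1}"]) (use x in \<open>auto simp: \<Phi>_on_graph\<close>)
  from fun_cong[OF has_derivative_unique[OF D1 this], of 1]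
  have D2: "?D (1, w1 x) = (J s x, ?g * J s x)" by simp
  have "deriv w x = w1 x" by (rule DERIV_imp_deriv[OF w(1)])
  hence "?D (tau w (x, w x)) = (1 / sqrt (1 + (w1 x)\<^sup>2)) *\<^sub>R (J s x, ?g * J s x)"
    using linear_cmul[OF has_derivative_linear[OF D]] by (simp only: tau_def fst_conv D2)
  moreover have "tau_s w \<Phi> s (\<Phi> s (x, w x)) = (1 / norm (?D (tau w (x, w x)))) *\<^sub>R ?D (tau w (x, w x))"
    unfolding tau_s_def inv Let_def ..
  \<comment> \<open>Only the direction matters for orthogonality; both normalisations are absorbed
    in \<open>k\<close>.\<close>
  ultimately obtain k where tau: "tau_s w \<Phi> s (\<Phi> s (x, w x)) = k *\<^sub>R (J s x, ?g * J s x)"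
    unfolding scaleR_scaleR by (metis (no_types) scaleR_scaleR)
  have "?v + ?g * (?g * ?v + f (\<xi> s x)) = ?g * f (\<xi> s x) - f (\<xi> s x) * (tilt ?g * (1 + ?g\<^sup>2))"
    by (simp add: V_def algebra_simps power2_eq_square)
  also have "\<dots> = 0" unfolding tilt_eq by simp
  finally have "k * J s x * (?v + ?g * (?g * ?v + f (\<xi> s x))) = 0" by simp
  thus ?thesis unfolding vel tau by (simp add: inner_Pair algebra_simps)
qed

end

section \<open>Choice of the constants and conclusion\<close>

theorem theorem3p1:
  fixes w :: "real \<Rightarrow> real" and \<alpha> :: real
  assumes "C3_real w"
    and "\<forall>x. w (x + 2) = w x"
    and "\<forall>x\<in>{-1..1}. w x > 0"
    and "0 < \<alpha>" and "\<alpha> < 1"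
  shows "\<exists>\<epsilon>>0. \<forall>a b p.
           -1 < a \<longrightarrow> a < b \<longrightarrow> b < 1 \<longrightarrow>
           (\<forall>k\<le>3. poly ((pderiv ^^ k) p) a = 0 \<and> poly ((pderiv ^^ k) p) b = 0) \<longrightarrow>
           C2alpha_norm \<alpha> a b (phi_ext a b p) < \<epsilon> \<longrightarrow>
           (\<exists>\<Phi>. admissible_flow \<Phi> \<and>
              (\<forall>s\<in>{0..1}.
                 \<Phi> s ` Gamma w = {(x, w x + s * phi_ext a b p x) | x. -1 < x \<and> x < 1}
               \<and> (\<forall>q\<in>\<Phi> s ` Gamma w. velocity \<Phi> s q \<bullet> tau_s w \<Phi> s q = 0)))"
proof -
  define w' where "w' k = (deriv ^^ k) w" for k
  have w': "(w' k has_real_derivative w' (Suc k) x) (at x)" if "k < 3" for k x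
    using assms(1) that unfolding C3_real_def w'_def by blast
  have w0: "w' 0 = w" by (simp add: w'_def)
  have w'': "(w has_real_derivative w' (Suc 0) x) (at x)"
    "(w' (Suc 0) has_real_derivative w' (Suc (Suc 0)) x) (at x)"
    "(w' (Suc (Suc 0)) has_real_derivative w' 3 x) (at x)" for x
    using w'[of 0 x] w'[of "Suc 0" x] w'[of "Suc (Suc 0)" x] by (simp_all add: w0 numeral_3_eq_3)
  have "continuous_on UNIV (w' 3)" using assms(1) by (simp add: C3_real_def w'_def)
  have c: "continuous_on {-1..1} w" "continuous_on {-1..1} (w' (Suc 0))" "continuous_on {-1..1} (w' (Suc (Suc 0)))"
    by (rule DERIV_continuous_on[OF has_field_derivative_at_within[OF w''(1)]]
             DERIV_continuous_on[OF has_field_derivative_at_within[OF w''(2)]]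
             DERIV_continuous_on[OF has_field_derivative_at_within[OF w''(3)]])+
  obtain x0 where x0: "x0 \<in> {-1..1}" "\<And>x. x \<in> {-1..1} \<Longrightarrow> w x0 \<le> w x"
    using continuous_attains_inf[OF compact_Icc _ c(1)] by auto
  obtain M where M: "\<forall>x\<in>{-1..1}. \<bar>w x\<bar> \<le> M"
    using continuous_on_Icc_bounded[OF c(1)] by blast
  obtain K1 where K1: "\<forall>x\<in>{-1..1}. \<bar>w' (Suc 0) x\<bar> \<le> K1"
    using continuous_on_Icc_bounded[OF c(2)] by blast
  obtain K2 where K2: "\<forall>x\<in>{-1..1}. \<bar>w' (Suc (Suc 0)) x\<bar> \<le> K2"
    using continuous_on_Icc_bounded[OF c(3)] by blast
  \<comment> \<open>The minimum of \<open>w\<close> is positive, so the support of the cut-off,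
    which begins at \<open>m/2\<close>, stays inside the strip.\<close>
  define m where "m = w x0"
  have m: "0 < m" "m \<le> M" using x0(1) assms(3) bspec[OF M x0(1)] by (auto simp: m_def)
  obtain \<eta> \<eta>' :: "real \<Rightarrow> real" and K3 where \<eta>:
    "C2_open UNIV \<eta>" "\<And>y. (\<eta> has_real_derivative \<eta>' y) (at y)"
    "\<And>y. \<bar>\<eta> y\<bar> \<le> 1" "\<And>y. \<bar>\<eta>' y\<bar> \<le> K3"
    "\<And>y. y \<in> {m..M} \<Longrightarrow> \<eta> y = 1" "\<And>y. y \<notin> {m/2..M+1} \<Longrightarrow> \<eta> y = 0"
    using exists_C2_cutoff[OF m] by blast
  define K where "K = max (max 1 K1) (max K2 K3)"
  \<comment> \<open>Fixed before \<open>a\<close>, \<open>b\<close> and \<open>p\<close>, so the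
    smallness condition depends on \<open>w\<close> alone.\<close>
  define \<epsilon> where "\<epsilon> = 1 / (100 * K\<^sup>2)"
  have K: "1 \<le> K" "K1 \<le> K" "K2 \<le> K" "K3 \<le> K" by (auto simp: K_def)
  show ?thesis
  proof (intro exI[of _ \<epsilon>] conjI allI impI)
    show "0 < \<epsilon>" using K(1) by (simp add: \<epsilon>_def)
    fix a b :: real and p :: "real poly"
    assume a: "-1 < a" and ab: "a < b" and b: "b < 1"
      and p: "\<forall>k\<le>3. poly ((pderiv ^^ k) p) a = 0 \<and> poly ((pderiv ^^ k) p) b = 0"
      and small: "C2alpha_norm \<alpha> a b (phi_ext a b p) < \<epsilon>"
    define f where "f k = phi_ext a b ((pderiv ^^ k) p)" for k
    have pk: "poly ((pderiv ^^ k) p) a = 0" "poly ((pderiv ^^ k) p) b = 0" if "k \<le> 3" for k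
      using p that by auto
    have f: "(f k has_real_derivative f (Suc k) x) (at x)" if "k < 3" for k x
      unfolding f_def funpow.simps comp_apply
      by (rule DERIV_phi_ext) (use that pk[of k] pk[of "Suc k"] in auto)
    have f_0: "f k x = 0" if "k \<le> 3" "x \<notin> {a<..<b}" for k x
      unfolding f_def by (rule phi_ext_eq_0[OF pk[OF that(1)] that(2)])
    have f_small: "\<bar>f k x\<bar> \<le> \<epsilon>" if "k \<le> 2" for k x
      unfolding f_def by (rule C2alpha_norm_phi_ext[OF p ab assms(4,5) small that])
    \<comment> \<open>Vanishing of the third derivative at the ends is what makes the third
      derivative of the extension continuous.\<close>
    have cf: "continuous_on UNIV (f 3)"
      unfolding f_def by (rule continuous_on_phi_ext[OF pk ab]) auto
    have f0: "f 0 = phi_ext a b p" by (simp add: f_def)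
    interpret normal_graph_flow w "w' (Suc 0)" "w' (Suc (Suc 0))" "w' 3"
      "f 0" "f (Suc 0)" "f (Suc (Suc 0))" "f 3" \<eta> \<eta>' a b "m/2" "M + 1" K \<epsilon>
    proof
      show "100 * K\<^sup>2 * \<epsilon> \<le> 1" using K(1) by (simp add: \<epsilon>_def)
      show "\<eta> (w x) = 1" if "x \<in> {-1..1}" for x
        using x0(2)[OF that] bspec[OF M that] by (intro \<eta>(5)) (auto simp: m_def)
      show "\<bar>w' (Suc 0) x\<bar> \<le> K" "\<bar>w' (Suc (Suc 0)) x\<bar> \<le> K" if "x \<in> {-1..1}" for x
        using bspec[OF K1 that] bspec[OF K2 that] K by linarith+
      show "\<bar>\<eta>' y\<bar> \<le> K" for y using \<eta>(4)[of y] K(4) by linarith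
    qed (use w'' f[of 0] f[of "Suc 0"] f[of "Suc (Suc 0)"] f_0 f_small cf a ab b \<eta>(1-3,6) m \<open>continuous_on UNIV (w' 3)\<close> K(1)
         in \<open>auto simp: numeral_2_eq_2 numeral_3_eq_3\<close>)
    show "\<exists>\<Phi>. admissible_flow \<Phi> \<and>
        (\<forall>s\<in>{0..1}.
           \<Phi> s ` Gamma w = {(x, w x + s * phi_ext a b p x) | x. -1 < x \<and> x < 1}
         \<and> (\<forall>q\<in>\<Phi> s ` Gamma w. velocity \<Phi> s q \<bullet> tau_s w \<Phi> s q = 0))"
    proof (intro exI[of _ \<Phi>] conjI ballI)
      show "admissible_flow \<Phi>" by (rule admissible_flow_\<Phi>)
      fix s :: real assume s: "s \<in> {0..1}"
      show "\<Phi> s ` Gamma w = {(x, w x + s * phi_ext a b p x) | x. -1 < x \<and> x < 1}"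
        using \<Phi>_image_graph[OF s] unfolding f0 .
      fix q assume "q \<in> \<Phi> s ` Gamma w"
      then obtain x where "q = \<Phi> s (x, w x)" "x \<in> {-1<..<1}" by (auto simp: Gamma_def)
      thus "velocity \<Phi> s q \<bullet> tau_s w \<Phi> s q = 0"
        using velocity_orthogonal[OF s, of x] assms(3) by simp
    qed
  qed
qed

end
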